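(* Suppose \(U_0\) is a uniform ultrafilter and \(U_1\) is a Dodd solid ultrafilter. If \(U_0<_S U_1\), then \(U_0<_M U_1\), i.e. \(U_0\in\mathrm{Ult}(V,U_1)\).
   Context: For a countably complete ultrafilter \(U\), \(\mathrm{Ult}(V,U)\) is the transitive collapse of the ultrapower, \(j_U\) its embedding and \([\mathrm{id}]_U\) the class of the identity. A uniform ultrafilter is a countably complete ultrafilter \(U\) on \([\kappa]^n\) (the \(n\)-element subsets of an ordinal \(\kappa\)) with \(\kappa\) least such that \([\kappa]^n\in U\); \(\mathrm{sp}(U)=\kappa\). Finite sets of ordinals are ordered by \(a<b\) iff the largest element of their symmetric difference lies in \(b\). For uniform \(U\) and finite \(a\subseteq\mathrm{Ord}\), \(U|a\) is the function with domain \(P(\mathrm{sp}(U))\), \(U|a(X)=j_U(X)\cap\{b\in[\mathrm{Ord}]^{<\omega}:b<a\}\); a nonprincipal uniform \(U\) is Dodd solid if \(U|[\mathrm{id}]_U\in\mathrm{Ult}(V,U)\). A comparison of \(\langle U_0,U_1\rangle\) by internal ultrafilters is a pair \(\langle W_0,W_1\rangle\) with \(W_i\in\mathrm{Ult}(V,U_i)\) a countably complete ultrafilter there, \(\mathrm{Ult}(\mathrm{Ult}(V,U_0),W_0)=\mathrm{Ult}(\mathrm{Ult}(V,U_1),W_1)\) and \(j_{W_0}\circ j_{U_0}=j_{W_1}\circ j_{U_1}\). \(U_0<_S U_1\) means there is such a comparison with \(j_{W_0}([\mathrm{id}]_{U_0})<j_{W_1}([\mathrm{id}]_{U_1})\)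.
   Formalization: In the definition of Dodd solid, U|a is taken with domain P([sp(U)]^{<ω}) (sets of finite subsets of sp(U)) instead of P(sp(U)); with the literal domain the claim fails for U normal and U_1 = U×U on [κ]^2. *)

theory Defs
  imports Main
begin

text \<open>
  The universe \<open>V\<close> is a type of class \<open>zfc\<close>; (proper) classes are values of type \<open>'v set\<close>, and a
  class is a set of the universe iff it is \<open>elts x\<close> for some \<open>x\<close>. Separation and Replacement are
  stated for arbitrary HOL predicates and functions.
\<close>

class zfc =
  fixes elts :: "'a \<Rightarrow> 'a set"
  assumes zfc_extensionality: "elts x = elts y \<Longrightarrow> x = y"
    and zfc_foundation: "elts x \<noteq> {} \<Longrightarrow> \<exists>y\<in>elts x. elts y \<inter> elts x = {}"
    and zfc_pairing: "\<exists>z. elts z = {x, y}"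
    and zfc_union: "\<exists>z. elts z = (\<Union>y\<in>elts x. elts y)"
    and zfc_powerset: "\<exists>z. elts z = {y. elts y \<subseteq> elts x}"
    and zfc_infinity:
      "\<exists>z. (\<exists>e\<in>elts z. elts e = {}) \<and> (\<forall>y\<in>elts z. \<exists>s\<in>elts z. elts s = insert y (elts y))"
    and zfc_separation: "\<exists>z. elts z = {y \<in> elts x. P y}"
    and zfc_replacement: "\<exists>z. elts z = F ` elts x"
    and zfc_choice:
      "\<forall>y\<in>elts x. elts y \<noteq> {} \<Longrightarrow>
       \<forall>y\<in>elts x. \<forall>z\<in>elts x. y \<noteq> z \<longrightarrow> elts y \<inter> elts z = {} \<Longrightarrow>
       \<exists>c. \<forall>y\<in>elts x. \<exists>!u. u \<in> elts c \<inter> elts y"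

text \<open>\<open>VSet A\<close> is unspecified if the class \<open>A\<close> is proper.\<close>

definition VSet :: "'v::zfc set \<Rightarrow> 'v" where
  "VSet A = (THE x. elts x = A)"

lemma VSet_elts [simp]: "VSet (elts x) = x"
  unfolding VSet_def by (rule the_equality) (auto intro: zfc_extensionality)

definition VPow :: "'v::zfc \<Rightarrow> 'v" where
  "VPow x = VSet {y. elts y \<subseteq> elts x}"

definition opair :: "'v::zfc \<Rightarrow> 'v \<Rightarrow> 'v" where
  "opair x y = VSet {VSet {x}, VSet {x, y}}"

definition is_fun :: "'v::zfc \<Rightarrow> 'v \<Rightarrow> bool" where
  "is_fun I f \<longleftrightarrow> (\<forall>p\<in>elts f. \<exists>i\<in>elts I. \<exists>y. p = opair i y) \<and>
                 (\<forall>i\<in>elts I. \<exists>!y. opair i y \<in> elts f)"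

definition app :: "'v::zfc \<Rightarrow> 'v \<Rightarrow> 'v" where
  "app f i = (THE y. opair i y \<in> elts f)"

definition VLambda :: "'v::zfc \<Rightarrow> ('v \<Rightarrow> 'v) \<Rightarrow> 'v" where
  "VLambda I F = VSet ((\<lambda>i. opair i (F i)) ` elts I)"


definition Transset :: "'v::zfc \<Rightarrow> bool" where
  "Transset x \<longleftrightarrow> (\<forall>y\<in>elts x. elts y \<subseteq> elts x)"

definition Ord :: "'v::zfc \<Rightarrow> bool" where
  "Ord x \<longleftrightarrow> Transset x \<and> (\<forall>y\<in>elts x. Transset y)"

definition omega :: "'v::zfc" where
  "omega = VSet {n. Ord n \<and> finite (elts n)}"

definition fin_ord_sets :: "'v::zfc set" where
  "fin_ord_sets = {b. finite (elts b) \<and> (\<forall>\<beta>\<in>elts b. Ord \<beta>)}"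

definition nsubsets :: "'v::zfc \<Rightarrow> nat \<Rightarrow> 'v" where
  "nsubsets \<kappa> n = VSet {a. elts a \<subseteq> elts \<kappa> \<and> finite (elts a) \<and> card (elts a) = n}"

definition finsubsets :: "'v::zfc \<Rightarrow> 'v" where
  "finsubsets \<kappa> = VSet {a. elts a \<subseteq> elts \<kappa> \<and> finite (elts a)}"

text \<open>The order on finite sets of ordinals; the ordinals are ordered by membership.\<close>

definition fos_less :: "'v::zfc \<Rightarrow> 'v \<Rightarrow> bool" where
  "fos_less a b \<longleftrightarrow>
     (\<exists>\<beta> \<in> elts b - elts a. \<forall>\<gamma> \<in> (elts a - elts b) \<union> (elts b - elts a). \<gamma> \<in> elts \<beta> \<or> \<gamma> = \<beta>)"


text \<open>
  \<open>cc_ultrafilter M I W\<close> is the statement that \<open>W\<close> is a countably complete ultrafilter on the set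
  \<open>I\<close>, with all quantifiers relativized to the transitive class \<open>M\<close> (the notions that occur are
  absolute). For \<open>M = UNIV\<close> it is the notion of the universe. Principal ultrafilters are included.
\<close>

definition cc_ultrafilter :: "'v::zfc set \<Rightarrow> 'v \<Rightarrow> 'v \<Rightarrow> bool" where
  "cc_ultrafilter M I W \<longleftrightarrow>
     I \<in> M \<and> W \<in> M \<and>
     elts W \<subseteq> {A \<in> M. elts A \<subseteq> elts I} \<and>
     I \<in> elts W \<and> VSet {} \<notin> elts W \<and>
     (\<forall>A\<in>elts W. \<forall>B\<in>M. elts A \<subseteq> elts B \<longrightarrow> elts B \<subseteq> elts I \<longrightarrow> B \<in> elts W) \<and>
     (\<forall>A\<in>elts W. \<forall>B\<in>elts W. VSet (elts A \<inter> elts B) \<in> elts W) \<and>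
     (\<forall>A\<in>M. elts A \<subseteq> elts I \<longrightarrow> A \<in> elts W \<or> VSet (elts I - elts A) \<in> elts W) \<and>
     (\<forall>s\<in>M. is_fun omega s \<longrightarrow> (\<forall>n\<in>elts omega. app s n \<in> elts W) \<longrightarrow>
        VSet {i \<in> elts I. \<forall>n\<in>elts omega. i \<in> elts (app s n)} \<in> elts W)"

text \<open>The set on which an ultrafilter lives is recovered as its union.\<close>

definition ground :: "'v::zfc \<Rightarrow> 'v" where
  "ground W = VSet (\<Union>A\<in>elts W. elts A)"

definition principal :: "'v::zfc \<Rightarrow> bool" where
  "principal U \<longleftrightarrow> (\<exists>i\<in>elts (ground U). elts U = {A. elts A \<subseteq> elts (ground U) \<and> i \<in> elts A})"


text \<open>
  The ultrapower of a transitive class \<open>M\<close> by \<open>W\<close>, built from the functions that belong to \<open>M\<close>: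
  its elements are the equivalence classes of \<open>ult_eq M W\<close>, its membership relation is
  \<open>ult_mem M W\<close>.
\<close>

definition ult_fun :: "'v::zfc set \<Rightarrow> 'v \<Rightarrow> 'v set" where
  "ult_fun M W = {f \<in> M. is_fun (ground W) f}"

definition ult_eq :: "'v::zfc set \<Rightarrow> 'v \<Rightarrow> ('v \<times> 'v) set" where
  "ult_eq M W = {(f, g). f \<in> ult_fun M W \<and> g \<in> ult_fun M W \<and>
     VSet {i \<in> elts (ground W). app f i = app g i} \<in> elts W}"

definition ult_mem :: "'v::zfc set \<Rightarrow> 'v \<Rightarrow> ('v set \<times> 'v set) set" where
  "ult_mem M W = {(F, G). F \<in> ult_fun M W // ult_eq M W \<and> G \<in> ult_fun M W // ult_eq M W \<and>
     (\<exists>f\<in>F. \<exists>g\<in>G. VSet {i \<in> elts (ground W). app f i \<in> elts (app g i)} \<in> elts W)}"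

text \<open>The Mostowski collapse of a well-founded, set-like relation.\<close>

definition collapse :: "('b \<times> 'b) set \<Rightarrow> 'b \<Rightarrow> 'v::zfc" where
  "collapse R = wfrec R (\<lambda>\<pi> x. VSet (\<pi> ` {y. (y, x) \<in> R}))"

definition Ult :: "'v::zfc set \<Rightarrow> 'v \<Rightarrow> 'v set" where
  "Ult M W = collapse (ult_mem M W) ` (ult_fun M W // ult_eq M W)"

definition ult_class :: "'v::zfc set \<Rightarrow> 'v \<Rightarrow> 'v \<Rightarrow> 'v" where
  "ult_class M W f = collapse (ult_mem M W) (ult_eq M W `` {f})"

definition ult_emb :: "'v::zfc set \<Rightarrow> 'v \<Rightarrow> 'v \<Rightarrow> 'v" where
  "ult_emb M W x = ult_class M W (VLambda (ground W) (\<lambda>_. x))"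

abbreviation UltV :: "'v::zfc \<Rightarrow> 'v set" where
  "UltV U \<equiv> Ult UNIV U"

abbreviation embV :: "'v::zfc \<Rightarrow> 'v \<Rightarrow> 'v" where
  "embV U \<equiv> ult_emb UNIV U"

definition ult_id :: "'v::zfc \<Rightarrow> 'v" where
  "ult_id U = ult_class UNIV U (VLambda (ground U) (\<lambda>i. i))"


definition uniform_on :: "'v::zfc \<Rightarrow> 'v \<Rightarrow> nat \<Rightarrow> bool" where
  "uniform_on U \<kappa> n \<longleftrightarrow> Ord \<kappa> \<and> cc_ultrafilter UNIV (nsubsets \<kappa> n) U \<and>
     (\<forall>\<alpha>\<in>elts \<kappa>. nsubsets \<alpha> n \<notin> elts U)"

definition uniform_ultrafilter :: "'v::zfc \<Rightarrow> bool" where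
  "uniform_ultrafilter U \<longleftrightarrow> (\<exists>\<kappa> n. uniform_on U \<kappa> n)"

definition sp :: "'v::zfc \<Rightarrow> 'v" where
  "sp U = (THE \<kappa>. \<exists>n. uniform_on U \<kappa> n)"

text \<open>
  The restriction \<open>U|a\<close>. Its values consist of finite sets of ordinals, so its arguments are the
  sets \<open>X\<close> of finite subsets of \<open>sp U\<close>. (For \<open>X\<close> a set of ordinals, the only members of \<open>j\<^sub>U(X)\<close>
  that are finite sets would be natural numbers.)
\<close>

definition ult_restrict :: "'v::zfc \<Rightarrow> 'v \<Rightarrow> 'v" where
  "ult_restrict U a = VLambda (VPow (finsubsets (sp U)))
     (\<lambda>X. VSet (elts (embV U X) \<inter> {b \<in> fin_ord_sets. fos_less b a}))"

definition Dodd_solid :: "'v::zfc \<Rightarrow> bool" where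
  "Dodd_solid U \<longleftrightarrow> uniform_ultrafilter U \<and> \<not> principal U \<and> ult_restrict U (ult_id U) \<in> UltV U"


definition internal_comparison :: "'v::zfc \<Rightarrow> 'v \<Rightarrow> 'v \<Rightarrow> 'v \<Rightarrow> bool" where
  "internal_comparison U0 U1 W0 W1 \<longleftrightarrow>
     (\<exists>I. cc_ultrafilter (UltV U0) I W0) \<and>
     (\<exists>I. cc_ultrafilter (UltV U1) I W1) \<and>
     Ult (UltV U0) W0 = Ult (UltV U1) W1 \<and>
     (\<forall>x. ult_emb (UltV U0) W0 (embV U0 x) = ult_emb (UltV U1) W1 (embV U1 x))"

definition seed_less :: "'v::zfc \<Rightarrow> 'v \<Rightarrow> bool" where
  "seed_less U0 U1 \<longleftrightarrow> (\<exists>W0 W1. internal_comparison U0 U1 W0 W1 \<and>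
     fos_less (ult_emb (UltV U0) W0 (ult_id U0)) (ult_emb (UltV U1) W1 (ult_id U1)))"

definition mitchell_less :: "'v::zfc \<Rightarrow> 'v \<Rightarrow> bool" where
  "mitchell_less U0 U1 \<longleftrightarrow> U0 \<in> UltV U1"

end

theory Submission
  imports Defs
begin

text \<open>
  Write \<open>j\<^sub>i\<close> for the embedding of \<open>U\<^sub>i\<close>, \<open>k\<^sub>i\<close> for that of \<open>W\<^sub>i\<close>, \<open>a\<^sub>i = [id]\<close>, \<open>y = k\<^sub>0(a\<^sub>0)\<close> and
  \<open>r = U\<^sub>1|a\<^sub>1\<close>. Since \<open>k\<^sub>0 \<circ> j\<^sub>0 = k\<^sub>1 \<circ> j\<^sub>1\<close> and \<open>y < k\<^sub>1(a\<^sub>1)\<close>, a set \<open>X\<close> is in \<open>U\<^sub>0\<close> iff \<open>a\<^sub>0 \<in> j\<^sub>0(X)\<close> iff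
  \<open>y \<in> k\<^sub>1(j\<^sub>1(X))\<close> iff \<open>y \<in> k\<^sub>1(r(X))\<close>. If \<open>y\<close> is represented by \<open>f\<close>, this says that
  \<open>{t. f(t) \<in> r(X)} \<in> W\<^sub>1\<close>, a condition on parameters of \<open>Ult(V, U\<^sub>1)\<close>, so \<open>U\<^sub>0\<close> is a set of
  \<open>Ult(V, U\<^sub>1)\<close> by Separation there.
\<close>

section \<open>Sets of the universe\<close>

text \<open>Replacing \<open>j\<^sub>1(X)\<close> by \<open>r(X)\<close> requires that
  \<open>f(t)\<close> be, for almost all \<open>t\<close>, a finite set of ordinals below
  \<open>a\<^sub>1\<close>. The given inequality \<open>y < k\<^sub>1(a\<^sub>1)\<close> holds in
  the second ultrapower and must be pulled back to the values of \<open>f\<close>; this works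
  because \<open>a\<^sub>1\<close> is finite, so that the ordinal witnessing the inequality is
  \<open>k\<^sub>1\<close> of an element of \<open>a\<^sub>1\<close>. The domain of \<open>r\<close>
  imposes another condition: it consists of the sets of finite subsets of
  \<open>sp U\<^sub>1\<close>, so \<open>sp U\<^sub>0\<close> must not exceed
  \<open>sp U\<^sub>1\<close>. The pointwise inequality bounds \<open>f(t)\<close> by
  \<open>j\<^sub>1\<close> of the finite subsets of \<open>sp U\<^sub>1\<close>, and minimality of
  \<open>sp U\<^sub>0\<close> then gives the comparison. The same domain supplies the set from which
  Separation carves out \<open>U\<^sub>0\<close>. As \<open>W\<^sub>1\<close> is an ultrafilter only
  inside \<open>Ult(V, U\<^sub>1)\<close>, ultrapowers are developed over inner models; closure
  under countable sequences makes the internal ones well-founded.\<close>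

definition small :: "'v::zfc set \<Rightarrow> bool" where
  "small A \<longleftrightarrow> (\<exists>x. elts x = A)"

lemma elts_VSet: "small A \<Longrightarrow> elts (VSet A) = A"
  by (auto simp: small_def)

lemma small_elts [simp, intro]: "small (elts x)"
  by (auto simp: small_def)

lemma small_subset: "small A \<Longrightarrow> B \<subseteq> A \<Longrightarrow> small B"
proof -
  assume "small A" and "B \<subseteq> A"
  then obtain x where "elts x = A"
    by (auto simp: small_def)
  with \<open>B \<subseteq> A\<close> have "{y \<in> elts x. y \<in> B} = B"
    by auto
  then show ?thesis
    unfolding small_def using zfc_separation[of x "\<lambda>y. y \<in> B"] by simp
qed

lemma small_Collect [simp, intro]: "small {y \<in> elts x. P y}"
  by (rule small_subset[OF small_elts[of x]]) auto

lemma small_image [intro]: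
  fixes F :: "'v::zfc \<Rightarrow> 'v"
  shows "small A \<Longrightarrow> small (F ` A)"
  unfolding small_def using zfc_replacement by blast

lemma small_pair [simp, intro]: "small {x, y}"
  unfolding small_def by (rule zfc_pairing)

lemma small_singleton [simp, intro]: "small {x}"
  using small_pair[of x x] by simp

lemma small_empty [simp, intro]: "small {}"
  by (rule small_subset[OF small_singleton]) auto

lemma small_UN:
  fixes B :: "'v::zfc \<Rightarrow> 'v set"
  assumes "small A" and "\<And>x. x \<in> A \<Longrightarrow> small (B x)"
  shows "small (\<Union>x\<in>A. B x)"
proof -
  obtain z where z: "elts z = (\<lambda>x. VSet (B x)) ` A"
    using small_image[OF assms(1)] unfolding small_def by blast
  have "(\<Union>y\<in>elts z. elts y) = (\<Union>x\<in>A. B x)"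
    using assms(2) by (auto simp: z elts_VSet)
  then show ?thesis
    using zfc_union[of z] unfolding small_def by metis
qed

lemma small_Un [intro]:
  assumes "small A" and "small B"
  shows "small (A \<union> B)"
proof -
  have "small (\<Union>y\<in>{VSet A, VSet B}. elts y)"
    by (rule small_UN) auto
  then show ?thesis
    using assms by (simp add: elts_VSet)
qed

lemma small_insert [intro]: "small A \<Longrightarrow> small (insert x A)"
  using small_Un[of "{x}" A] by simp

lemma small_Pow [intro]:
  assumes "small A"
  shows "small {y. elts y \<subseteq> A}"
  using assms zfc_powerset unfolding small_def by blast

lemma mem_irrefl: "x \<notin> elts x"
  using zfc_foundation[of "VSet {x}"] by (auto simp: elts_VSet)

lemma opair_eq_iff [simp]: "opair a b = opair c d \<longleftrightarrow> a = c \<and> b = d"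
proof
  assume eq: "opair a b = opair c d"
  have "elts (opair x y) = {VSet {x}, VSet {x, y}}" for x y :: 'a
    by (simp add: opair_def elts_VSet)
  with eq have "{VSet {a}, VSet {a, b}} = {VSet {c}, VSet {c, d}}"
    by metis
  then have "elts ` {VSet {a}, VSet {a, b}} = elts ` {VSet {c}, VSet {c, d}}"
    by simp
  then have "{{a}, {a, b}} = {{c}, {c, d}}"
    by (simp add: elts_VSet)
  then show "a = c \<and> b = d"
    by (auto simp: doubleton_eq_iff)
qed simp

lemma elts_VLambda: "elts (VLambda I F) = (\<lambda>i. opair i (F i)) ` elts I"
  unfolding VLambda_def by (intro elts_VSet small_image) simp

lemma is_fun_VLambda [simp, intro]: "is_fun I (VLambda I F)"
  by (auto simp: is_fun_def elts_VLambda)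

lemma app_VLambda [simp]: "i \<in> elts I \<Longrightarrow> app (VLambda I F) i = F i"
  by (auto simp: app_def elts_VLambda)

lemma app_iff: "is_fun I f \<Longrightarrow> opair i y \<in> elts f \<longleftrightarrow> i \<in> elts I \<and> app f i = y"
proof
  assume f: "is_fun I f" and y: "opair i y \<in> elts f"
  then have i: "i \<in> elts I"
    by (auto simp: is_fun_def)
  with f have "\<exists>!y. opair i y \<in> elts f"
    by (simp add: is_fun_def)
  with y i show "i \<in> elts I \<and> app f i = y"
    by (auto simp: app_def intro: the1_equality)
next
  assume f: "is_fun I f" and y: "i \<in> elts I \<and> app f i = y"
  then have "\<exists>!y. opair i y \<in> elts f"
    by (simp add: is_fun_def)
  with y show "opair i y \<in> elts f"
    unfolding app_def by (metis theI')
qed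

lemma VLambda_app: "is_fun I f \<Longrightarrow> VLambda I (app f) = f"
proof (rule zfc_extensionality)
  assume f: "is_fun I f"
  show "elts (VLambda I (app f)) = elts f"
  proof
    show "elts (VLambda I (app f)) \<subseteq> elts f"
      using app_iff[OF f] by (auto simp: elts_VLambda)
    show "elts f \<subseteq> elts (VLambda I (app f))"
    proof
      fix p
      assume p: "p \<in> elts f"
      with f obtain i y where "p = opair i y"
        by (auto simp: is_fun_def)
      with p show "p \<in> elts (VLambda I (app f))"
        using app_iff[OF f] by (auto simp: elts_VLambda)
    qed
  qed
qed

section \<open>Ordinals and the natural numbers\<close>

primrec vnat :: "nat \<Rightarrow> 'v::zfc" where
  "vnat 0 = VSet {}"
| "vnat (Suc n) = VSet (insert (vnat n) (elts (vnat n)))"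

lemma elts_vnat: "elts (vnat n :: 'v::zfc) = vnat ` {..<n}"
proof (induction n)
  case 0
  show ?case
    by (simp add: elts_VSet)
next
  case (Suc n)
  have "elts (vnat (Suc n) :: 'v) = insert (vnat n) (elts (vnat n))"
    unfolding vnat.simps by (intro elts_VSet small_insert small_elts)
  then show ?case
    using Suc by (simp add: lessThan_Suc del: vnat.simps)
qed

lemma inj_vnat: "inj vnat"
proof (rule linorder_injI)
  fix m n :: nat
  assume "m < n"
  then have "vnat m \<in> elts (vnat n)"
    by (auto simp: elts_vnat)
  then show "vnat m \<noteq> (vnat n :: 'a)"
    using mem_irrefl by metis
qed

text \<open>The set given by Infinity contains every \<open>vnat n\<close>, and Replacement applied
  along the inverse of \<open>vnat\<close> turns any HOL sequence into a set. Foundation thereby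
  excludes descending HOL sequences.\<close>

lemma small_range_nat: "small (range (F :: nat \<Rightarrow> 'v::zfc))"
proof -
  obtain z e :: 'v where e: "e \<in> elts z" "elts e = {}"
    and z: "\<forall>y\<in>elts z. \<exists>s\<in>elts z. elts s = insert y (elts y)"
    using zfc_infinity by blast
  have "vnat n \<in> elts z" for n
  proof (induction n)
    case 0
    then show ?case
      using e VSet_elts[of e] by simp
  next
    case (Suc n)
    then show ?case
      using z VSet_elts by (metis vnat.simps(2))
  qed
  then have "small (range (vnat :: nat \<Rightarrow> 'v))"
    by (intro small_subset[OF small_elts[of z]]) auto
  then have "small ((\<lambda>x. F (inv vnat x)) ` range (vnat :: nat \<Rightarrow> 'v))"
    by (rule small_image)
  then show ?thesis
    by (simp add: image_image inv_f_f[OF inj_vnat])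
qed

lemma no_descending_seq: "\<exists>n. a (Suc n) \<notin> elts (a n)"
proof -
  have "elts (VSet (range a)) = range a"
    by (intro elts_VSet small_range_nat)
  then show ?thesis
    using zfc_foundation[of "VSet (range a)"] by force
qed

lemma wf_mem: "wf {(x, y). x \<in> elts y}"
  unfolding wf_iff_no_infinite_down_chain using no_descending_seq by auto

lemma elts_induct: "(\<And>x. (\<And>y. y \<in> elts x \<Longrightarrow> P y) \<Longrightarrow> P x) \<Longrightarrow> P x"
  using wf_induct[OF wf_mem, of P x] by auto

lemma Ord_mem_trans: "Ord c \<Longrightarrow> b \<in> elts c \<Longrightarrow> a \<in> elts b \<Longrightarrow> a \<in> elts c"
  by (auto simp: Ord_def Transset_def)

lemma Ord_in_Ord: "Ord b \<Longrightarrow> a \<in> elts b \<Longrightarrow> Ord a"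
  unfolding Ord_def Transset_def by blast

lemma Ord_linear: "Ord a \<Longrightarrow> Ord b \<Longrightarrow> a \<in> elts b \<or> a = b \<or> b \<in> elts a"
proof (induction a arbitrary: b rule: elts_induct)
  case (1 a)
  note outer = 1
  from outer(3) show ?case
  proof (induction b rule: elts_induct)
    case (1 b)
    show ?case
    proof (rule ccontr)
      assume n: "\<not> ?case"
      have "elts a \<subseteq> elts b"
        using outer(1,2) n 1(2) by (metis Ord_in_Ord Ord_mem_trans subsetI)
      moreover have "elts b \<subseteq> elts a"
        using 1 n by (metis Ord_in_Ord Ord_mem_trans subsetI)
      ultimately show False
        using n zfc_extensionality by blast
    qed
  qed
qed

lemma Ord_vnat: "Ord (vnat n)"
  by (auto simp: Ord_def Transset_def elts_vnat)

text \<open>An ordinal other than all \<open>vnat n\<close> is comparable with the set of these,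
  hence includes it and is infinite.\<close>

lemma elts_omega: "elts omega = range vnat"
proof -
  let ?w = "VSet (range vnat) :: 'a"
  have w: "elts ?w = range vnat"
    by (intro elts_VSet small_range_nat)
  have "Ord ?w"
    by (auto simp: Ord_def Transset_def w elts_vnat)
  have "x \<in> range vnat" if "Ord x" "finite (elts x)" for x :: 'a
  proof (rule ccontr)
    assume "x \<notin> range vnat"
    then have "range vnat \<subseteq> elts x"
      using Ord_linear[OF \<open>Ord x\<close> \<open>Ord ?w\<close>] Ord_mem_trans[OF \<open>Ord x\<close>] w by blast
    then show False
      using finite_subset[OF _ that(2)] finite_imageD[OF _ inj_vnat] infinite_UNIV_nat by blast
  qed
  then have "{n :: 'a. Ord n \<and> finite (elts n)} = range vnat"
    by (auto simp: Ord_vnat elts_vnat)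
  then show ?thesis
    unfolding omega_def using w by simp
qed

section \<open>Ultrapowers of inner models\<close>

text \<open>
  The closure properties of \<open>M\<close> used in forming ultrapowers by ultrafilters in \<open>M\<close>. The last one
  chooses elements of \<open>(f(i) \<triangle> g(i)) - e(i)\<close> wherever there are any; it serves both
  extensionality of the ultrapower and the transfer of the order on finite sets of ordinals.
\<close>

locale inner_model =
  fixes M :: "'v::zfc set"
  assumes M_trans: "x \<in> M \<Longrightarrow> y \<in> elts x \<Longrightarrow> y \<in> M"
    and M_empty: "VSet {} \<in> M"
    and M_seq: "(\<And>k::nat. A k \<in> M) \<Longrightarrow> VSet (range A) \<in> M"
    and M_const: "I \<in> M \<Longrightarrow> x \<in> M \<Longrightarrow> VLambda I (\<lambda>_. x) \<in> M"
    and M_eq: "I \<in> M \<Longrightarrow> f \<in> M \<Longrightarrow> g \<in> M \<Longrightarrow> is_fun I f \<Longrightarrow> is_fun I g \<Longrightarrow>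
      VSet {i \<in> elts I. app f i = app g i} \<in> M"
    and M_mem: "I \<in> M \<Longrightarrow> f \<in> M \<Longrightarrow> g \<in> M \<Longrightarrow> is_fun I f \<Longrightarrow> is_fun I g \<Longrightarrow>
      VSet {i \<in> elts I. app f i \<in> elts (app g i)} \<in> M"
    and M_choice: "I \<in> M \<Longrightarrow> f \<in> M \<Longrightarrow> g \<in> M \<Longrightarrow> e \<in> M \<Longrightarrow> is_fun I f \<Longrightarrow> is_fun I g \<Longrightarrow> is_fun I e \<Longrightarrow>
      \<exists>h\<in>M. is_fun I h \<and> (\<forall>i\<in>elts I. \<forall>z. (z \<in> elts (app f i) \<longleftrightarrow> z \<notin> elts (app g i)) \<longrightarrow>
        z \<notin> elts (app e i) \<longrightarrow>
        (app h i \<in> elts (app f i) \<longleftrightarrow> app h i \<notin> elts (app g i)) \<and> app h i \<notin> elts (app e i))"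
begin

lemma M_pair: "x \<in> M \<Longrightarrow> y \<in> M \<Longrightarrow> VSet {x, y} \<in> M"
proof -
  assume "x \<in> M" and "y \<in> M"
  then have "VSet (range (\<lambda>k::nat. if k = 0 then x else y)) \<in> M"
    by (intro M_seq) simp
  moreover have "range (\<lambda>k::nat. if k = 0 then x else y) = {x, y}"
    by (auto split: if_splits)
  ultimately show ?thesis
    by simp
qed

lemma M_opair: "x \<in> M \<Longrightarrow> y \<in> M \<Longrightarrow> opair x y \<in> M"
  unfolding opair_def using M_pair[of x x] by (simp add: M_pair)

lemma M_vnat: "vnat k \<in> M"
proof (induction k rule: less_induct)
  case (less k)
  show ?case
  proof (cases k)
    case 0
    then show ?thesis
      by (simp add: M_empty)
  next
    case (Suc m)
    \<comment> \<open>Closure of \<open>M\<close> is given for infinite sequences only;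
      \<open>min j m\<close> lists the finitely many predecessors as such a sequence.\<close>
    have "VSet (range (\<lambda>j. vnat (min j m))) \<in> M"
      by (intro M_seq less) (auto simp: Suc)
    moreover have "range (\<lambda>j. min j m) = {..<k}"
    proof
      show "{..<k} \<subseteq> range (\<lambda>j. min j m)"
        by (rule subsetI, rule_tac x = x in range_eqI) (simp add: Suc)
    qed (auto simp: Suc)
    then have "range (\<lambda>j. vnat (min j m)) = elts (vnat k :: 'v)"
      unfolding elts_vnat by (metis image_image)
    ultimately show ?thesis
      by simp
  qed
qed

text \<open>Countable completeness in \<open>cc_ultrafilter\<close> speaks of functions on
  \<open>omega\<close> that belong to \<open>M\<close>; this is the bridge to them from HOL
  sequences.\<close>

lemma M_omega_seq:
  assumes "\<And>k::nat. A k \<in> M"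
  shows "VLambda omega (\<lambda>n. A (inv vnat n)) \<in> M"
proof -
  have "VSet (range (\<lambda>k. opair (vnat k) (A k))) \<in> M"
    by (intro M_seq M_opair M_vnat assms)
  then show ?thesis
    by (simp add: VLambda_def elts_omega image_image inv_f_f[OF inj_vnat])
qed

end

text \<open>Only the recursion equation: that the class under \<open>VSet\<close> is a set is a
  separate matter, settled for ultrapowers by \<open>small_preds\<close>.\<close>

lemma collapse_unfold:
  "wf R \<Longrightarrow> collapse R x = VSet (collapse R ` {y. (y, x) \<in> R})"
  unfolding collapse_def
  by (subst wfrec, assumption) (auto simp: cut_apply intro!: arg_cong[where f = VSet] image_cong)

locale ultrapower = inner_model M for M :: "'v::zfc set" +
  fixes I W :: 'v
  assumes cc: "cc_ultrafilter M I W"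
begin

section \<open>The quantifier "for almost all indices"\<close>

abbreviation "funs \<equiv> ult_fun M W"
abbreviation "cls \<equiv> ult_class M W"
abbreviation "eqr \<equiv> ult_eq M W"

definition ae :: "('v \<Rightarrow> bool) \<Rightarrow> bool" where
  "ae P \<longleftrightarrow> VSet {i \<in> elts I. P i} \<in> elts W"

text \<open>\<open>W\<close> decides only the subsets of \<open>I\<close> that lie in
  \<open>M\<close>, so passing to a weaker property or to a negation carries this side
  condition.\<close>

definition meas :: "('v \<Rightarrow> bool) \<Rightarrow> bool" where
  "meas P \<longleftrightarrow> VSet {i \<in> elts I. P i} \<in> M"

lemma I_M: "I \<in> M"
  using cc by (simp add: cc_ultrafilter_def)

lemma W_M: "W \<in> M"
  using cc by (simp add: cc_ultrafilter_def)

lemma elts_sub [simp]: "elts (VSet {i \<in> elts I. P i}) = {i \<in> elts I. P i}"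
  by (rule elts_VSet) simp

lemma W_sub: "A \<in> elts W \<Longrightarrow> A \<in> M \<and> elts A \<subseteq> elts I"
  using cc by (auto simp: cc_ultrafilter_def)

lemma I_W: "I \<in> elts W"
  using cc by (simp add: cc_ultrafilter_def)

lemma ground_W: "ground W = I"
proof -
  have "(\<Union>A\<in>elts W. elts A) = elts I"
    using W_sub I_W by blast
  then show ?thesis
    by (simp add: ground_def)
qed

lemma ae_mono:
  assumes "ae P" and "meas Q" and "\<And>i. i \<in> elts I \<Longrightarrow> P i \<Longrightarrow> Q i"
  shows "ae Q"
proof -
  have "\<forall>A\<in>elts W. \<forall>B\<in>M. elts A \<subseteq> elts B \<longrightarrow> elts B \<subseteq> elts I \<longrightarrow> B \<in> elts W"
    using cc by (simp add: cc_ultrafilter_def)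
  then show ?thesis
    using assms unfolding ae_def meas_def by (metis (no_types, lifting) elts_sub mem_Collect_eq subsetI)
qed

lemma ae_conj:
  assumes "ae P" and "ae Q"
  shows "ae (\<lambda>i. P i \<and> Q i)"
proof -
  have "\<forall>A\<in>elts W. \<forall>B\<in>elts W. VSet (elts A \<inter> elts B) \<in> elts W"
    using cc by (simp add: cc_ultrafilter_def)
  then have "VSet (elts (VSet {i \<in> elts I. P i}) \<inter> elts (VSet {i \<in> elts I. Q i})) \<in> elts W"
    using assms unfolding ae_def by blast
  moreover have "{i \<in> elts I. P i} \<inter> {i \<in> elts I. Q i} = {i \<in> elts I. P i \<and> Q i}"
    by auto
  ultimately show ?thesis
    by (simp add: ae_def)
qed

lemma ae_ex: "ae P \<Longrightarrow> \<exists>i\<in>elts I. P i"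
proof (rule ccontr)
  assume "ae P" and "\<not> (\<exists>i\<in>elts I. P i)"
  then have "{i \<in> elts I. P i} = {}"
    by blast
  with \<open>ae P\<close> cc show False
    by (simp add: ae_def cc_ultrafilter_def)
qed

lemma ae_not:
  assumes "meas P"
  shows "ae (\<lambda>i. \<not> P i) \<longleftrightarrow> \<not> ae P"
proof
  assume "ae (\<lambda>i. \<not> P i)"
  then show "\<not> ae P"
    using ae_ex[OF ae_conj[of P "\<lambda>i. \<not> P i"]] by blast
next
  assume n: "\<not> ae P"
  have "\<forall>A\<in>M. elts A \<subseteq> elts I \<longrightarrow> A \<in> elts W \<or> VSet (elts I - elts A) \<in> elts W"
    using cc by (simp add: cc_ultrafilter_def)
  then have "VSet (elts I - elts (VSet {i \<in> elts I. P i})) \<in> elts W"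
    using n assms unfolding ae_def meas_def by fastforce
  moreover have "elts I - {i \<in> elts I. P i} = {i \<in> elts I. \<not> P i}"
    by auto
  ultimately show "ae (\<lambda>i. \<not> P i)"
    by (simp add: ae_def)
qed

lemma ae_True: "(\<And>i. i \<in> elts I \<Longrightarrow> P i) \<Longrightarrow> ae P"
proof -
  assume "\<And>i. i \<in> elts I \<Longrightarrow> P i"
  then have "{i \<in> elts I. P i} = elts I"
    by auto
  then show ?thesis
    by (simp add: ae_def I_W)
qed

lemma ae_cong: "(\<And>i. i \<in> elts I \<Longrightarrow> P i = Q i) \<Longrightarrow> ae P = ae Q"
  unfolding ae_def by (metis (mono_tags, lifting) Collect_cong)

text \<open>Completeness of \<open>W\<close> is internal to \<open>M\<close>, but closure of
  \<open>M\<close> under sequences makes every external sequence of members of \<open>W\<close> an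
  internal one.\<close>

lemma ae_nat:
  assumes "\<And>k::nat. ae (P k)"
  shows "ae (\<lambda>i. \<forall>k. P k i)"
proof -
  define A where "A = (\<lambda>k. VSet {i \<in> elts I. P k i})"
  define s where "s = VLambda omega (\<lambda>n. A (inv vnat n))"
  have A: "A k \<in> elts W" "A k \<in> M" for k
    using assms[of k] W_sub by (auto simp: A_def ae_def)
  have app_s: "app s (vnat k) = A k" for k
    unfolding s_def by (subst app_VLambda) (auto simp: elts_omega inv_f_f[OF inj_vnat])
  have "s \<in> M"
    unfolding s_def by (intro M_omega_seq A)
  moreover have "is_fun omega s"
    by (simp add: s_def)
  moreover have "\<forall>n\<in>elts omega. app s n \<in> elts W"
    by (auto simp: elts_omega app_s A)
  ultimately have "VSet {i \<in> elts I. \<forall>n\<in>elts omega. i \<in> elts (app s n)} \<in> elts W"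
    using cc unfolding cc_ultrafilter_def by blast
  moreover have "{i \<in> elts I. \<forall>n\<in>elts omega. i \<in> elts (app s n)} = {i \<in> elts I. \<forall>k. P k i}"
    by (auto simp: elts_omega app_s A_def)
  ultimately show ?thesis
    by (simp add: ae_def)
qed

section \<open>Representatives, the membership relation and its collapse\<close>

lemma funsD: "f \<in> funs \<Longrightarrow> f \<in> M" "f \<in> funs \<Longrightarrow> is_fun I f"
  by (auto simp: ult_fun_def ground_W)

lemma funsI: "f \<in> M \<Longrightarrow> is_fun I f \<Longrightarrow> f \<in> funs"
  by (auto simp: ult_fun_def ground_W)

lemma funs_const: "x \<in> M \<Longrightarrow> VLambda I (\<lambda>_. x) \<in> funs"
  by (intro funsI M_const I_M) auto

lemma meas_eq: "f \<in> funs \<Longrightarrow> g \<in> funs \<Longrightarrow> meas (\<lambda>i. app f i = app g i)"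
  unfolding meas_def by (intro M_eq I_M funsD)

lemma meas_mem: "f \<in> funs \<Longrightarrow> g \<in> funs \<Longrightarrow> meas (\<lambda>i. app f i \<in> elts (app g i))"
  unfolding meas_def by (intro M_mem I_M funsD)

lemma eqr_iff: "(f, g) \<in> eqr \<longleftrightarrow> f \<in> funs \<and> g \<in> funs \<and> ae (\<lambda>i. app f i = app g i)"
  by (simp add: ult_eq_def ae_def ground_W)

lemma equiv_eqr: "equiv funs eqr"
proof (rule equivI)
  show "eqr \<subseteq> funs \<times> funs"
    by (auto simp: eqr_iff)
  show "refl_on funs eqr"
    by (auto simp: refl_on_def eqr_iff intro: ae_True)
  show "sym eqr"
    by (auto simp: sym_def eqr_iff eq_commute)
  show "trans eqr"
  proof (rule transI)
    fix f g h
    assume "(f, g) \<in> eqr" and "(g, h) \<in> eqr"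
    then have "f \<in> funs" "h \<in> funs" "ae (\<lambda>i. app f i = app g i \<and> app g i = app h i)"
      by (simp_all add: eqr_iff ae_conj)
    moreover from this have "ae (\<lambda>i. app f i = app h i)"
      by (elim ae_mono) (simp_all add: meas_eq)
    ultimately show "(f, h) \<in> eqr"
      by (simp add: eqr_iff)
  qed
qed

lemma eqr_class_iff:
  "f \<in> funs \<Longrightarrow> g \<in> funs \<Longrightarrow> eqr `` {f} = eqr `` {g} \<longleftrightarrow> ae (\<lambda>i. app f i = app g i)"
  using eq_equiv_class_iff[OF equiv_eqr] by (simp add: eqr_iff)

lemma ult_mem_iff:
  assumes "f \<in> funs" and "g \<in> funs"
  shows "(eqr `` {f}, eqr `` {g}) \<in> ult_mem M W \<longleftrightarrow> ae (\<lambda>i. app f i \<in> elts (app g i))"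
proof
  assume "(eqr `` {f}, eqr `` {g}) \<in> ult_mem M W"
  then obtain f' g' where "(f, f') \<in> eqr" "(g, g') \<in> eqr" "ae (\<lambda>i. app f' i \<in> elts (app g' i))"
    by (auto simp: ult_mem_def ae_def ground_W)
  then have "ae (\<lambda>i. app f i = app f' i \<and> app g i = app g' i \<and> app f' i \<in> elts (app g' i))"
    unfolding eqr_iff by (intro ae_conj) auto
  then show "ae (\<lambda>i. app f i \<in> elts (app g i))"
    by (rule ae_mono) (auto intro: meas_mem assms)
next
  assume "ae (\<lambda>i. app f i \<in> elts (app g i))"
  moreover have "f \<in> eqr `` {f}" "g \<in> eqr `` {g}"
    using assms equiv_class_self[OF equiv_eqr] by auto
  ultimately show "(eqr `` {f}, eqr `` {g}) \<in> ult_mem M W"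
    using assms by (auto simp: ult_mem_def ae_def ground_W intro: quotientI)
qed

lemma ult_memE:
  assumes "(x, y) \<in> ult_mem M W"
  obtains f g where "f \<in> funs" "g \<in> funs" "x = eqr `` {f}" "y = eqr `` {g}"
  using assms by (auto simp: ult_mem_def elim!: quotientE)

text \<open>Along a descending sequence each step holds almost everywhere, so all steps hold
  together at some index, which contradicts Foundation there.\<close>

lemma wf_ult_mem: "wf (ult_mem M W)"
  unfolding wf_iff_no_infinite_down_chain
proof
  assume "\<exists>x. \<forall>n. (x (Suc n), x n) \<in> ult_mem M W"
  then obtain x where x: "(x (Suc n), x n) \<in> ult_mem M W" for n
    by blast
  have "\<exists>f. f \<in> funs \<and> x n = eqr `` {f}" for n
    using x[of n] by (auto elim: ult_memE)
  then obtain f where f: "f n \<in> funs" "x n = eqr `` {f n}" for n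
    by metis
  then have "ae (\<lambda>i. app (f (Suc n)) i \<in> elts (app (f n) i))" for n
    using x[of n] by (simp add: ult_mem_iff)
  then have "ae (\<lambda>i. \<forall>n. app (f (Suc n)) i \<in> elts (app (f n) i))"
    by (rule ae_nat)
  from ae_ex[OF this] obtain i where "\<forall>n. app (f (Suc n)) i \<in> elts (app (f n) i)"
    by blast
  then show False
    using no_descending_seq[of "\<lambda>n. app (f n) i"] by simp
qed

lemma ult_mem_preds:
  assumes "g \<in> funs"
  shows "{y. (y, eqr `` {g}) \<in> ult_mem M W} =
    (\<lambda>f. eqr `` {f}) ` {f \<in> funs. ae (\<lambda>i. app f i \<in> elts (app g i))}"
proof -
  have "y \<in> (\<lambda>f. eqr `` {f}) ` {f \<in> funs. ae (\<lambda>i. app f i \<in> elts (app g i))}"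
    if "(y, eqr `` {g}) \<in> ult_mem M W" for y
  proof -
    from that obtain f where f: "f \<in> funs" "y = eqr `` {f}"
      by (auto elim: ult_memE)
    with that show ?thesis
      using assms by (simp add: ult_mem_iff)
  qed
  then show ?thesis
    using assms by (auto simp: ult_mem_iff)
qed

text \<open>A member of the class of \<open>g\<close> is determined by the graph of one of its representatives \<open>f\<close>,
  restricted to the arguments \<open>i\<close> with \<open>f(i) \<in> g(i)\<close>; these graphs are subsets of one set.\<close>

lemma small_preds:
  fixes \<pi> :: "'v set \<Rightarrow> 'v"
  assumes g: "g \<in> funs"
  shows "small (\<pi> ` {y. (y, eqr `` {g}) \<in> ult_mem M W})"
proof -
  define F where "F = {f \<in> funs. ae (\<lambda>i. app f i \<in> elts (app g i))}"
  define G where "G f = (\<lambda>i. opair i (app f i)) ` {i \<in> elts I. app f i \<in> elts (app g i)}" for f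
  have G: "elts (VSet (G f)) = G f" for f
    unfolding G_def by (intro elts_VSet small_image) simp
  have same: "eqr `` {f} = eqr `` {f'}" if "f \<in> F" "f' \<in> F" "G f = G f'" for f f'
  proof -
    have "app f i = app f' i" if "i \<in> elts I" "app f i \<in> elts (app g i)" for i
    proof -
      have "opair i (app f i) \<in> G f'"
        using that \<open>G f = G f'\<close> by (auto simp: G_def)
      then show ?thesis
        by (auto simp: G_def)
    qed
    then have "ae (\<lambda>i. app f i = app f' i)"
      using that by (rule_tac ae_mono[of "\<lambda>i. app f i \<in> elts (app g i)"]) (simp_all add: F_def meas_eq)
    then show ?thesis
      using that by (subst eqr_class_iff) (auto simp: F_def)
  qed
  let ?T = "\<Union>i\<in>elts I. opair i ` elts (app g i)"
  have "small {y. elts y \<subseteq> ?T}"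
    by (intro small_Pow small_UN small_image) simp_all
  then have "small ((\<lambda>f. VSet (G f)) ` F)"
    by (rule small_subset) (auto simp: G, auto simp: G_def)
  \<comment> \<open>Replacement applies to functions on the universe, whereas an equivalence class
    may be a proper class. The image is therefore indexed by the graphs, with a representative
    chosen for each graph.\<close>
  then have "small ((\<lambda>s. \<pi> (eqr `` {SOME f. f \<in> F \<and> VSet (G f) = s})) ` (\<lambda>f. VSet (G f)) ` F)"
    by (rule small_image)
  also have "(\<lambda>s. \<pi> (eqr `` {SOME f. f \<in> F \<and> VSet (G f) = s})) ` (\<lambda>f. VSet (G f)) ` F =
      (\<lambda>f. \<pi> (eqr `` {f})) ` F"
    unfolding image_image
  proof (rule image_cong)
    fix f
    assume f: "f \<in> F"
    let ?f = "SOME f'. f' \<in> F \<and> VSet (G f') = VSet (G f)"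
    have "?f \<in> F \<and> VSet (G ?f) = VSet (G f)"
      by (rule someI[of _ f]) (simp add: f)
    then have "G ?f = G f" "?f \<in> F"
      using G by metis+
    then show "\<pi> (eqr `` {?f}) = \<pi> (eqr `` {f})"
      using same f by metis
  qed simp
  finally show ?thesis
    by (simp add: ult_mem_preds[OF g] F_def image_image)
qed

lemma elts_cls:
  "g \<in> funs \<Longrightarrow> elts (cls g) = cls ` {f \<in> funs. ae (\<lambda>i. app f i \<in> elts (app g i))}"
  unfolding ult_class_def
  by (subst collapse_unfold[OF wf_ult_mem], subst elts_VSet[OF small_preds])
    (auto simp: ult_mem_preds image_image)

lemma funs_choice:
  assumes "f \<in> funs" "g \<in> funs" "e \<in> funs"
  obtains h where "h \<in> funs"
    "\<And>i z. i \<in> elts I \<Longrightarrow> z \<in> elts (app f i) \<longleftrightarrow> z \<notin> elts (app g i) \<Longrightarrow> z \<notin> elts (app e i) \<Longrightarrow>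
      (app h i \<in> elts (app f i) \<longleftrightarrow> app h i \<notin> elts (app g i)) \<and> app h i \<notin> elts (app e i)"
proof -
  obtain h where "h \<in> M" "is_fun I h" and h: "\<forall>i\<in>elts I. \<forall>z. (z \<in> elts (app f i) \<longleftrightarrow> z \<notin> elts (app g i)) \<longrightarrow>
      z \<notin> elts (app e i) \<longrightarrow>
      (app h i \<in> elts (app f i) \<longleftrightarrow> app h i \<notin> elts (app g i)) \<and> app h i \<notin> elts (app e i)"
    using M_choice[OF I_M funsD(1)[OF assms(1)] funsD(1)[OF assms(2)] funsD(1)[OF assms(3)]
        funsD(2)[OF assms(1)] funsD(2)[OF assms(2)] funsD(2)[OF assms(3)]] by blast
  show thesis
    by (rule that[OF funsI[OF \<open>h \<in> M\<close> \<open>is_fun I h\<close>] h[rule_format]])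
qed

text \<open>The ultrapower is extensional, so its collapse is injective, by induction on the class
  of \<open>f\<close> for all \<open>g\<close> at once. If \<open>f\<close> and \<open>g\<close>
  differed almost everywhere, a function \<open>h\<close> picking elements of the symmetric
  differences would represent a member of exactly one of the two classes, while the collapses
  agree.\<close>

lemma cls_inj:
  assumes "f \<in> funs" and "g \<in> funs" and "cls f = cls g"
  shows "ae (\<lambda>i. app f i = app g i)"
proof -
  have "\<forall>y. x \<in> funs // eqr \<longrightarrow> y \<in> funs // eqr \<longrightarrow>
      collapse (ult_mem M W) x = (collapse (ult_mem M W) y :: 'v) \<longrightarrow> x = y" for x
  proof (induction x rule: wf_induct_rule[OF wf_ult_mem])
    case (1 x)
    show ?case
    proof (intro allI impI, rule ccontr)
      fix y
      assume "x \<in> funs // eqr" "y \<in> funs // eqr" "x \<noteq> y"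
        and coll: "collapse (ult_mem M W) x = (collapse (ult_mem M W) y :: 'v)"
      then obtain f g where f: "f \<in> funs" "x = eqr `` {f}" and g: "g \<in> funs" "y = eqr `` {g}"
        by (auto elim!: quotientE)
      have same: "cls f = cls g"
        using coll by (simp add: ult_class_def f g)
      have "\<not> ae (\<lambda>i. app f i = app g i)"
        using \<open>x \<noteq> y\<close> f g eqr_class_iff by simp
      then have ne: "ae (\<lambda>i. app f i \<noteq> app g i)"
        using ae_not[OF meas_eq[OF f(1) g(1)]] by simp
      \<comment> \<open>The excluded set in \<open>funs_choice\<close> is empty here: any element of
        the symmetric difference will do.\<close>
      obtain h where h: "h \<in> funs" and
        h': "\<And>i z. i \<in> elts I \<Longrightarrow> z \<in> elts (app f i) \<longleftrightarrow> z \<notin> elts (app g i) \<Longrightarrow>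
          z \<notin> elts (app (VLambda I (\<lambda>_. VSet {})) i) \<Longrightarrow>
          (app h i \<in> elts (app f i) \<longleftrightarrow> app h i \<notin> elts (app g i)) \<and>
          app h i \<notin> elts (app (VLambda I (\<lambda>_. VSet {})) i)"
        using funs_choice[OF f(1) g(1) funs_const[OF M_empty]] by metis
      have h'': "app h i \<in> elts (app f i) \<longleftrightarrow> app h i \<notin> elts (app g i)"
        if i: "i \<in> elts I" "app f i \<noteq> app g i" for i
      proof -
        obtain z where "z \<in> elts (app f i) \<longleftrightarrow> z \<notin> elts (app g i)"
          using i(2) zfc_extensionality by blast
        then show ?thesis
          using h'[OF i(1), of z] i(1) by (simp add: elts_VSet)
      qed
      \<comment> \<open>The function \<open>k'\<close> below \<open>f\<close> to which the induction
        applies is \<open>h\<close> itself in one case and the function matched with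
        \<open>h\<close> in the other.\<close>
      have IH: "ae (\<lambda>i. app k' i = app k i)"
        if "k \<in> funs" "k' \<in> funs" "cls k' = cls k" "ae (\<lambda>i. app k' i \<in> elts (app f i))" for k k'
      proof -
        have "(eqr `` {k'}, x) \<in> ult_mem M W"
          using that f by (simp add: ult_mem_iff)
        then have "eqr `` {k'} = eqr `` {k}"
          using 1[of "eqr `` {k'}"] that by (auto simp: ult_class_def quotientI)
        then show ?thesis
          using eqr_class_iff that by simp
      qed
      show False
      proof (cases "ae (\<lambda>i. app h i \<in> elts (app f i))")
        case True
        then have "cls h \<in> elts (cls g)"
          using h same elts_cls[OF f(1)] by auto
        then obtain k where k: "k \<in> funs" "cls h = cls k" "ae (\<lambda>i. app k i \<in> elts (app g i))"
          using elts_cls[OF g(1)] by auto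
        have "ae (\<lambda>i. app h i = app k i)"
          using IH[of k h] k h True by simp
        from ae_ex[OF ae_conj[OF ae_conj[OF this True] ae_conj[OF ne k(3)]]] show False
          using h'' by metis
      next
        case False
        then have nf: "ae (\<lambda>i. app h i \<notin> elts (app f i))"
          using ae_not[OF meas_mem[OF h f(1)]] by simp
        then have "ae (\<lambda>i. app h i \<in> elts (app g i))"
          by (rule ae_mono[OF ae_conj[OF ne]]) (auto intro: meas_mem h g simp: h'')
        then have "cls h \<in> elts (cls f)"
          using h same elts_cls[OF g(1)] by auto
        then obtain k where k: "k \<in> funs" "cls h = cls k" "ae (\<lambda>i. app k i \<in> elts (app f i))"
          using elts_cls[OF f(1)] by auto
        have "ae (\<lambda>i. app k i = app h i)"
          using IH[of h k] k h by simp
        from ae_ex[OF ae_conj[OF ae_conj[OF this nf] k(3)]] show False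
          by auto
      qed
    qed
  qed
  then have "eqr `` {f} = eqr `` {g}"
    using assms unfolding ult_class_def by (meson quotientI)
  then show ?thesis
    using eqr_class_iff assms by simp
qed

lemma cls_eq_iff: "f \<in> funs \<Longrightarrow> g \<in> funs \<Longrightarrow> cls f = cls g \<longleftrightarrow> ae (\<lambda>i. app f i = app g i)"
  using cls_inj eqr_class_iff by (metis ult_class_def)

lemma cls_mem_iff:
  assumes "f \<in> funs" and "g \<in> funs"
  shows "cls f \<in> elts (cls g) \<longleftrightarrow> ae (\<lambda>i. app f i \<in> elts (app g i))"
proof
  assume "cls f \<in> elts (cls g)"
  then obtain k where k: "k \<in> funs" "cls f = cls k" "ae (\<lambda>i. app k i \<in> elts (app g i))"
    using elts_cls[OF assms(2)] by auto
  then have "ae (\<lambda>i. app f i = app k i)"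
    using cls_inj assms by simp
  from ae_conj[OF this k(3)] show "ae (\<lambda>i. app f i \<in> elts (app g i))"
    by (rule ae_mono) (auto intro: meas_mem assms)
qed (use assms in \<open>auto simp: elts_cls\<close>)

lemma Ult_eq: "Ult M W = cls ` funs"
  by (auto simp: Ult_def ult_class_def quotient_def)

lemma cls_mem_Ult: "f \<in> funs \<Longrightarrow> cls f \<in> Ult M W"
  by (simp add: Ult_eq)

lemma ult_emb_eq: "ult_emb M W x = cls (VLambda I (\<lambda>_. x))"
  by (simp add: ult_emb_def ground_W)

end

section \<open>Ultrapowers of the universe\<close>

lemma inner_model_UNIV: "inner_model (UNIV :: 'v::zfc set)"
proof
  fix I f g e :: 'v
  define h where "h = VLambda I (\<lambda>i. SOME z. (z \<in> elts (app f i) \<longleftrightarrow> z \<notin> elts (app g i)) \<and> z \<notin> elts (app e i))"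
  have "(app h i \<in> elts (app f i) \<longleftrightarrow> app h i \<notin> elts (app g i)) \<and> app h i \<notin> elts (app e i)"
    if "i \<in> elts I" and "z \<in> elts (app f i) \<longleftrightarrow> z \<notin> elts (app g i)" and "z \<notin> elts (app e i)" for i z
    unfolding h_def app_VLambda[OF that(1)] by (rule someI[of _ z]) (use that in blast)
  then show "\<exists>h\<in>UNIV. is_fun I h \<and> (\<forall>i\<in>elts I. \<forall>z. (z \<in> elts (app f i) \<longleftrightarrow> z \<notin> elts (app g i)) \<longrightarrow>
      z \<notin> elts (app e i) \<longrightarrow>
      (app h i \<in> elts (app f i) \<longleftrightarrow> app h i \<notin> elts (app g i)) \<and> app h i \<notin> elts (app e i))"
    unfolding h_def by blast
qed auto

locale V_ultrapower =
  fixes I U :: "'v::zfc"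
  assumes cc_UNIV: "cc_ultrafilter UNIV I U"
begin

sublocale ultrapower UNIV I U
  using inner_model_UNIV cc_UNIV by (simp add: ultrapower_def ultrapower_axioms_def)

text \<open>Over the universe every HOL function restricted to \<open>I\<close> is a set, so
  representatives can be written as HOL terms in the index.\<close>

definition cf :: "('v \<Rightarrow> 'v) \<Rightarrow> 'v" where
  "cf f = cls (VLambda I f)"

abbreviation "N \<equiv> UltV U"

lemma meas_UNIV [simp]: "meas P"
  by (simp add: meas_def)

lemma VLambda_funs [simp]: "VLambda I f \<in> funs"
  by (simp add: funsI)

lemma cf_mem_iff: "cf f \<in> elts (cf g) \<longleftrightarrow> ae (\<lambda>i. f i \<in> elts (g i))"
  unfolding cf_def by (subst cls_mem_iff) (auto intro!: ae_cong)

lemma cf_eq_iff: "cf f = cf g \<longleftrightarrow> ae (\<lambda>i. f i = g i)"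
  unfolding cf_def by (subst cls_eq_iff) (auto intro!: ae_cong)

lemma N_eq: "N = range cf"
proof -
  have "funs = range (VLambda I)"
    using VLambda_app funsD(2) VLambda_funs by (metis image_subset_iff rangeI subsetI subset_antisym)
  then show ?thesis
    unfolding Ult_eq cf_def[abs_def] by (simp add: image_image)
qed

lemma cf_N [simp]: "cf f \<in> N"
  by (simp add: N_eq)

lemma N_cases: "x \<in> N \<Longrightarrow> (\<And>f. x = cf f \<Longrightarrow> P) \<Longrightarrow> P"
  by (auto simp: N_eq)

lemma N_trans: "x \<in> N \<Longrightarrow> y \<in> elts x \<Longrightarrow> y \<in> N"
  unfolding Ult_eq using elts_cls by blast

text \<open>
  Los's theorem is a calculus: the rules for \<open>los P Q\<close> build the interpretation \<open>Q\<close> of a formula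
  in the ultrapower along with the formula \<open>P i\<close> about representatives.
\<close>

definition los :: "('v \<Rightarrow> bool) \<Rightarrow> bool \<Rightarrow> bool" where
  "los P Q \<longleftrightarrow> (ae P \<longleftrightarrow> Q)"

lemma losD: "los P Q \<Longrightarrow> Q \<longleftrightarrow> ae P"
  by (simp add: los_def)

lemma los_mem: "los (\<lambda>i. f i \<in> elts (g i)) (cf f \<in> elts (cf g))"
  by (simp add: los_def cf_mem_iff)

lemma los_eq: "los (\<lambda>i. f i = g i) (cf f = cf g)"
  by (simp add: los_def cf_eq_iff)

lemma los_not: "los P Q \<Longrightarrow> los (\<lambda>i. \<not> P i) (\<not> Q)"
  by (simp add: los_def ae_not)

lemma los_conj:
  assumes "los P Q" and "los P' Q'"
  shows "los (\<lambda>i. P i \<and> P' i) (Q \<and> Q')"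
proof -
  have "ae (\<lambda>i. P i \<and> P' i) \<longleftrightarrow> ae P \<and> ae P'"
    by (auto intro: ae_conj elim: ae_mono)
  with assms show ?thesis
    by (simp add: los_def)
qed

lemma los_disj:
  assumes "los P Q" and "los P' Q'"
  shows "los (\<lambda>i. P i \<or> P' i) (Q \<or> Q')"
proof -
  have "los (\<lambda>i. \<not> (\<not> P i \<and> \<not> P' i)) (\<not> (\<not> Q \<and> \<not> Q'))"
    by (intro los_not los_conj assms)
  then show ?thesis
    by simp
qed

lemma los_imp:
  assumes "los P Q" and "los P' Q'"
  shows "los (\<lambda>i. P i \<longrightarrow> P' i) (Q \<longrightarrow> Q')"
  unfolding imp_conv_disj by (intro los_disj los_not assms)

lemma los_iff:
  assumes "los P Q" and "los P' Q'"
  shows "los (\<lambda>i. P i \<longleftrightarrow> P' i) (Q \<longleftrightarrow> Q')"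
  unfolding iff_conv_conj_imp by (intro los_conj los_imp assms)

text \<open>Choosing a witness at each index yields a representative of a witness in
  \<open>N\<close>.\<close>

lemma los_ex:
  assumes "\<And>f. los (\<lambda>i. P i (f i)) (Q (cf f))"
  shows "los (\<lambda>i. \<exists>x. P i x) (\<exists>x\<in>N. Q x)"
  unfolding los_def
proof
  assume "ae (\<lambda>i. \<exists>x. P i x)"
  then have "ae (\<lambda>i. P i (SOME x. P i x))"
    by (rule ae_mono) (auto intro: someI)
  then show "\<exists>x\<in>N. Q x"
    using assms[of "\<lambda>i. SOME x. P i x"] by (auto simp: los_def)
next
  assume "\<exists>x\<in>N. Q x"
  then obtain f where "Q (cf f)"
    by (auto elim: N_cases)
  then have "ae (\<lambda>i. P i (f i))"
    using assms by (simp add: los_def)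
  then show "ae (\<lambda>i. \<exists>x. P i x)"
    by (rule ae_mono) auto
qed

lemma los_all:
  assumes "\<And>f. los (\<lambda>i. P i (f i)) (Q (cf f))"
  shows "los (\<lambda>i. \<forall>x. P i x) (\<forall>x\<in>N. Q x)"
proof -
  have "los (\<lambda>i. \<not> (\<exists>x. \<not> P i x)) (\<not> (\<exists>x\<in>N. \<not> Q x))"
    by (intro los_not los_ex assms)
  then show ?thesis
    by simp
qed

text \<open>Transitivity of \<open>N\<close> removes the relativization from bounded
  quantifiers.\<close>

lemma los_bex:
  assumes "\<And>f. los (\<lambda>i. P i (f i)) (Q (cf f))"
  shows "los (\<lambda>i. \<exists>x\<in>elts (g i). P i x) (\<exists>x\<in>elts (cf g). Q x)"
proof -
  have "los (\<lambda>i. \<exists>x. x \<in> elts (g i) \<and> P i x) (\<exists>x\<in>N. x \<in> elts (cf g) \<and> Q x)"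
    by (intro los_ex los_conj los_mem assms)
  moreover have "(\<exists>x\<in>N. x \<in> elts (cf g) \<and> Q x) \<longleftrightarrow> (\<exists>x\<in>elts (cf g). Q x)"
    using N_trans cf_N by blast
  ultimately show ?thesis
    by (simp add: Bex_def)
qed

lemma los_ball:
  assumes "\<And>f. los (\<lambda>i. P i (f i)) (Q (cf f))"
  shows "los (\<lambda>i. \<forall>x\<in>elts (g i). P i x) (\<forall>x\<in>elts (cf g). Q x)"
proof -
  have "los (\<lambda>i. \<not> (\<exists>x\<in>elts (g i). \<not> P i x)) (\<not> (\<exists>x\<in>elts (cf g). \<not> Q x))"
    by (intro los_not los_bex assms)
  then show ?thesis
    by simp
qed

text \<open>This goes beyond first-order formulas: countable conjunctions transfer by countable
  completeness.\<close>

lemma los_all_nat: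
  assumes "\<And>k::nat. los (P k) (Q k)"
  shows "los (\<lambda>i. \<forall>k. P k i) (\<forall>k. Q k)"
  unfolding los_def
proof
  assume "ae (\<lambda>i. \<forall>k. P k i)"
  then have "ae (P k)" for k
    by (rule ae_mono) auto
  then show "\<forall>k. Q k"
    using assms by (simp add: los_def)
next
  assume "\<forall>k. Q k"
  then show "ae (\<lambda>i. \<forall>k. P k i)"
    using assms by (intro ae_nat) (simp add: los_def)
qed

lemma los_ex_nat:
  assumes "\<And>k::nat. los (P k) (Q k)"
  shows "los (\<lambda>i. \<exists>k. P k i) (\<exists>k. Q k)"
proof -
  have "los (\<lambda>i. \<not> (\<forall>k. \<not> P k i)) (\<not> (\<forall>k. \<not> Q k))"
    by (intro los_not los_all_nat assms)
  then show ?thesis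
    by simp
qed

text \<open>The pattern behind the closure properties of \<open>N\<close>: perform a construction at
  every index and identify by Los the elements of what it represents.\<close>

lemma elts_cfI:
  assumes "X \<subseteq> N" and "\<And>h. los (\<lambda>i. h i \<in> elts (f i)) (cf h \<in> X)"
  shows "elts (cf f) = X"
proof -
  have "x \<in> elts (cf f) \<longleftrightarrow> x \<in> X" if x: "x \<in> N" for x
    using x
  proof (rule N_cases)
    fix h
    assume "x = cf h"
    then show ?thesis
      using assms(2)[of h] by (simp add: los_def cf_mem_iff)
  qed
  then show ?thesis
    using assms(1) N_trans[OF cf_N] by blast
qed

lemma VSet_N: "elts (cf f) = X \<Longrightarrow> VSet X \<in> N"
  by (drule sym) simp

lemma cf_pair: "cf (\<lambda>i. VSet {f i, g i}) = VSet {cf f, cf g}"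
proof -
  have "elts (cf (\<lambda>i. VSet {f i, g i})) = {cf f, cf g}"
    by (rule elts_cfI) (auto simp: elts_VSet intro!: los_disj los_eq)
  from arg_cong[OF this, of VSet] show ?thesis
    by simp
qed

lemma cf_opair: "cf (\<lambda>i. opair (f i) (g i)) = opair (cf f) (cf g)"
  using cf_pair[of f f] by (simp add: opair_def cf_pair)

lemma los_opair_mem: "los (\<lambda>i. opair (f i) (g i) \<in> elts (h i)) (opair (cf f) (cf g) \<in> elts (cf h))"
  unfolding cf_opair[symmetric] by (rule los_mem)

lemma los_eq_opair: "los (\<lambda>i. h i = opair (f i) (g i)) (cf h = opair (cf f) (cf g))"
  unfolding cf_opair[symmetric] by (rule los_eq)

lemmas los_intros = los_conj los_disj los_not los_imp los_iff los_ex los_all los_bex los_ball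
  los_mem los_eq los_opair_mem los_eq_opair

lemma N_opair: "opair x y \<in> N \<Longrightarrow> x \<in> N \<and> y \<in> N"
proof -
  assume "opair x y \<in> N"
  then have *: "VSet {x, y} \<in> N"
    by (rule N_trans) (simp add: opair_def elts_VSet)
  show ?thesis
    by (intro conjI; rule N_trans[OF *]) (simp_all add: elts_VSet)
qed

text \<open>Separation at each index gives a representative. The predicate \<open>Q\<close> must
  come with an interpretation \<open>P\<close>, which stands in for definability over
  \<open>N\<close>.\<close>

lemma N_separation:
  assumes "A \<in> N" and "\<And>h. los (\<lambda>i. P i (h i)) (Q (cf h))"
  shows "VSet {x \<in> elts A. Q x} \<in> N"
  using assms(1)
proof (rule N_cases)
  fix a
  assume A: "A = cf a"
  have "elts (cf (\<lambda>i. VSet {x \<in> elts (a i). P i x})) = {x \<in> elts A. Q x}"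
  proof (rule elts_cfI)
    show "{x \<in> elts A. Q x} \<subseteq> N"
      using N_trans[OF assms(1)] by blast
    show "los (\<lambda>i. h i \<in> elts (VSet {x \<in> elts (a i). P i x})) (cf h \<in> {x \<in> elts A. Q x})" for h
      unfolding A elts_VSet[OF small_Collect] mem_Collect_eq by (intro los_conj los_mem assms(2))
  qed
  then show ?thesis
    by (rule VSet_N)
qed

lemma N_Union: "A \<in> N \<Longrightarrow> VSet (\<Union>x\<in>elts A. elts x) \<in> N"
proof (erule N_cases)
  fix a
  assume A: "A = cf a"
  have Un: "elts (VSet (\<Union>x\<in>elts y. elts x)) = (\<Union>x\<in>elts y. elts x)" for y :: 'v
    by (intro elts_VSet small_UN) auto
  have "elts (cf (\<lambda>i. VSet (\<Union>x\<in>elts (a i). elts x))) = (\<Union>x\<in>elts A. elts x)"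
  proof (rule elts_cfI)
    show "(\<Union>x\<in>elts A. elts x) \<subseteq> N"
      using N_trans cf_N A by blast
    show "los (\<lambda>i. h i \<in> elts (VSet (\<Union>x\<in>elts (a i). elts x))) (cf h \<in> (\<Union>x\<in>elts A. elts x))" for h
      unfolding A Un UN_iff by (intro los_intros)
  qed
  then show ?thesis
    by (rule VSet_N)
qed

text \<open>After a choice of representatives for all terms, the sequence of their values at an
  index is again a set, and the countable disjunction transfers.\<close>

lemma N_seq:
  assumes "\<And>k::nat. A k \<in> N"
  shows "VSet (range A) \<in> N"
proof -
  obtain a where a: "A k = cf (a k)" for k
    using assms unfolding N_eq image_iff by metis
  have "elts (cf (\<lambda>i. VSet (range (\<lambda>k. a k i)))) = range A"
  proof (rule elts_cfI)
    show "range A \<subseteq> N"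
      using assms by blast
    show "los (\<lambda>i. h i \<in> elts (VSet (range (\<lambda>k. a k i)))) (cf h \<in> range A)" for h
      unfolding elts_VSet[OF small_range_nat] image_iff a bex_UNIV by (intro los_ex_nat los_eq)
  qed
  then show ?thesis
    by (rule VSet_N)
qed

lemma N_const: "J \<in> N \<Longrightarrow> x \<in> N \<Longrightarrow> VLambda J (\<lambda>_. x) \<in> N"
proof (erule N_cases, erule N_cases)
  fix j f
  assume J: "J = cf j" "x = cf f"
  have "elts (cf (\<lambda>i. VLambda (j i) (\<lambda>_. f i))) = (\<lambda>t. opair t x) ` elts J"
  proof (rule elts_cfI)
    show "(\<lambda>t. opair t x) ` elts J \<subseteq> N"
    proof
      fix p
      assume "p \<in> (\<lambda>t. opair t x) ` elts J"
      then obtain t where "t \<in> elts J" "p = opair t x"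
        by auto
      moreover from this obtain h where "t = cf h"
        using N_trans[OF cf_N] N_cases unfolding J by metis
      ultimately show "p \<in> N"
        by (simp add: J flip: cf_opair)
    qed
    show "los (\<lambda>i. h i \<in> elts (VLambda (j i) (\<lambda>_. f i))) (cf h \<in> (\<lambda>t. opair t x) ` elts J)" for h
      unfolding elts_VLambda image_iff J by (intro los_intros)
  qed
  then show ?thesis
    unfolding VLambda_def by (rule VSet_N)
qed

text \<open>Los gives the statement relativized to \<open>N\<close>; the relativization is harmless
  because both components of a pair in \<open>cf f\<close> lie in \<open>N\<close>.\<close>

lemma los_is_fun: "los (\<lambda>i. is_fun (j i) (f i)) (is_fun (cf j) (cf f))"
proof -
  have "los (\<lambda>i. (\<forall>p\<in>elts (f i). \<exists>t\<in>elts (j i). \<exists>y. p = opair t y) \<and>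
      (\<forall>t\<in>elts (j i). \<exists>y. opair t y \<in> elts (f i) \<and> (\<forall>z. opair t z \<in> elts (f i) \<longrightarrow> z = y)))
    ((\<forall>p\<in>elts (cf f). \<exists>t\<in>elts (cf j). \<exists>y\<in>N. p = opair t y) \<and>
      (\<forall>t\<in>elts (cf j). \<exists>y\<in>N. opair t y \<in> elts (cf f) \<and> (\<forall>z\<in>N. opair t z \<in> elts (cf f) \<longrightarrow> z = y)))"
    by (intro los_intros)
  moreover have "(\<forall>p\<in>elts (f i). \<exists>t\<in>elts (j i). \<exists>y. p = opair t y) \<and>
      (\<forall>t\<in>elts (j i). \<exists>y. opair t y \<in> elts (f i) \<and> (\<forall>z. opair t z \<in> elts (f i) \<longrightarrow> z = y)) \<longleftrightarrow>
      is_fun (j i) (f i)" for i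
    unfolding is_fun_def Ex1_def by (rule refl)
  moreover have p: "x \<in> N \<and> y \<in> N" if "opair x y \<in> elts (cf f)" for x y
    using N_trans[OF cf_N that] by (rule N_opair)
  have "(\<exists>t\<in>elts (cf j). \<exists>y\<in>N. q = opair t y) \<longleftrightarrow> (\<exists>t\<in>elts (cf j). \<exists>y. q = opair t y)"
    if "q \<in> elts (cf f)" for q
    using that by (auto dest: p)
  then have "(\<forall>p\<in>elts (cf f). \<exists>t\<in>elts (cf j). \<exists>y\<in>N. p = opair t y) \<longleftrightarrow>
      (\<forall>p\<in>elts (cf f). \<exists>t\<in>elts (cf j). \<exists>y. p = opair t y)"
    by simp
  moreover have "(\<forall>t\<in>elts (cf j). \<exists>y\<in>N. opair t y \<in> elts (cf f) \<and> (\<forall>z\<in>N. opair t z \<in> elts (cf f) \<longrightarrow> z = y)) \<longleftrightarrow>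
      (\<forall>t\<in>elts (cf j). \<exists>!y. opair t y \<in> elts (cf f))"
    unfolding Ex1_def using p by meson
  ultimately show ?thesis
    unfolding is_fun_def[of "cf j"] by simp
qed

text \<open>The choices are made at each index and transferred by Los. Since \<open>app\<close> is a
  definite description and has no rule in the calculus, the transferred formula names values through
  ordered pairs.\<close>

lemma N_choice:
  assumes "J \<in> N" "x \<in> N" "y \<in> N" "z \<in> N" and "is_fun J x" "is_fun J y" "is_fun J z"
  shows "\<exists>w\<in>N. is_fun J w \<and> (\<forall>t\<in>elts J. \<forall>u. (u \<in> elts (app x t) \<longleftrightarrow> u \<notin> elts (app y t)) \<longrightarrow>
      u \<notin> elts (app z t) \<longrightarrow>
      (app w t \<in> elts (app x t) \<longleftrightarrow> app w t \<notin> elts (app y t)) \<and> app w t \<notin> elts (app z t))"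
proof -
  obtain j f g e where cfs: "J = cf j" "x = cf f" "y = cf g" "z = cf e"
    using assms(1-4) by (auto elim!: N_cases)
  define h where "h i = VLambda (j i) (\<lambda>t. SOME u.
      (u \<in> elts (app (f i) t) \<longleftrightarrow> u \<notin> elts (app (g i) t)) \<and> u \<notin> elts (app (e i) t))" for i
  have fn: "ae (\<lambda>i. is_fun (j i) (f i) \<and> is_fun (j i) (g i) \<and> is_fun (j i) (e i))"
    using assms(5-7) losD[OF los_is_fun] by (intro ae_conj) (simp_all add: cfs)
  have "is_fun J (cf h)"
    unfolding cfs losD[OF los_is_fun] by (rule ae_True) (simp add: h_def)
  have L: "los (\<lambda>i. \<forall>t\<in>elts (j i). \<forall>a. \<forall>b. \<forall>c. \<forall>d. opair t a \<in> elts (f i) \<longrightarrow> opair t b \<in> elts (g i) \<longrightarrow>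
        opair t c \<in> elts (e i) \<longrightarrow> opair t d \<in> elts (h i) \<longrightarrow>
        (\<forall>u. (u \<in> elts a \<longleftrightarrow> u \<notin> elts b) \<longrightarrow> u \<notin> elts c \<longrightarrow> (d \<in> elts a \<longleftrightarrow> d \<notin> elts b) \<and> d \<notin> elts c))
      (\<forall>t\<in>elts (cf j). \<forall>a\<in>N. \<forall>b\<in>N. \<forall>c\<in>N. \<forall>d\<in>N. opair t a \<in> elts (cf f) \<longrightarrow> opair t b \<in> elts (cf g) \<longrightarrow>
        opair t c \<in> elts (cf e) \<longrightarrow> opair t d \<in> elts (cf h) \<longrightarrow>
        (\<forall>u\<in>N. (u \<in> elts a \<longleftrightarrow> u \<notin> elts b) \<longrightarrow> u \<notin> elts c \<longrightarrow> (d \<in> elts a \<longleftrightarrow> d \<notin> elts b) \<and> d \<notin> elts c))"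
    by (intro los_intros)
  have A: "ae (\<lambda>i. \<forall>t\<in>elts (j i). \<forall>a. \<forall>b. \<forall>c. \<forall>d. opair t a \<in> elts (f i) \<longrightarrow> opair t b \<in> elts (g i) \<longrightarrow>
        opair t c \<in> elts (e i) \<longrightarrow> opair t d \<in> elts (h i) \<longrightarrow>
        (\<forall>u. (u \<in> elts a \<longleftrightarrow> u \<notin> elts b) \<longrightarrow> u \<notin> elts c \<longrightarrow> (d \<in> elts a \<longleftrightarrow> d \<notin> elts b) \<and> d \<notin> elts c))"
    using fn
  proof (rule ae_mono)
    fix i
    assume i: "is_fun (j i) (f i) \<and> is_fun (j i) (g i) \<and> is_fun (j i) (e i)"
    have "(d \<in> elts a \<longleftrightarrow> d \<notin> elts b) \<and> d \<notin> elts c"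
      if t: "t \<in> elts (j i)" and *: "opair t a \<in> elts (f i)" "opair t b \<in> elts (g i)"
        "opair t c \<in> elts (e i)" "opair t d \<in> elts (h i)"
        and u: "u \<in> elts a \<longleftrightarrow> u \<notin> elts b" "u \<notin> elts c" for t a b c d u
    proof -
      have abc: "app (f i) t = a" "app (g i) t = b" "app (e i) t = c"
        using i * app_iff by blast+
      have "is_fun (j i) (h i)"
        by (simp add: h_def)
      then have "app (h i) t = d"
        using * app_iff by blast
      define P where "P u \<longleftrightarrow> (u \<in> elts a \<longleftrightarrow> u \<notin> elts b) \<and> u \<notin> elts c" for u
      have "d = (SOME u. P u)"
        using t \<open>app (h i) t = d\<close> by (simp add: h_def abc P_def)
      moreover have "P u"
        using u by (simp add: P_def)
      ultimately have "P d"
        using someI by metis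
      then show ?thesis
        unfolding P_def .
    qed
    then show "\<forall>t\<in>elts (j i). \<forall>a. \<forall>b. \<forall>c. \<forall>d. opair t a \<in> elts (f i) \<longrightarrow> opair t b \<in> elts (g i) \<longrightarrow>
        opair t c \<in> elts (e i) \<longrightarrow> opair t d \<in> elts (h i) \<longrightarrow>
        (\<forall>u. (u \<in> elts a \<longleftrightarrow> u \<notin> elts b) \<longrightarrow> u \<notin> elts c \<longrightarrow> (d \<in> elts a \<longleftrightarrow> d \<notin> elts b) \<and> d \<notin> elts c)"
      by blast
  qed simp
  have main: "\<forall>t\<in>elts J. \<forall>a\<in>N. \<forall>b\<in>N. \<forall>c\<in>N. \<forall>d\<in>N. opair t a \<in> elts x \<longrightarrow> opair t b \<in> elts y \<longrightarrow>
        opair t c \<in> elts z \<longrightarrow> opair t d \<in> elts (cf h) \<longrightarrow>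
        (\<forall>u\<in>N. (u \<in> elts a \<longleftrightarrow> u \<notin> elts b) \<longrightarrow> u \<notin> elts c \<longrightarrow> (d \<in> elts a \<longleftrightarrow> d \<notin> elts b) \<and> d \<notin> elts c)"
    unfolding cfs by (rule iffD2[OF losD[OF L] A])
  have "(app (cf h) t \<in> elts (app x t) \<longleftrightarrow> app (cf h) t \<notin> elts (app y t)) \<and> app (cf h) t \<notin> elts (app z t)"
    if t: "t \<in> elts J" and u: "u \<in> elts (app x t) \<longleftrightarrow> u \<notin> elts (app y t)" "u \<notin> elts (app z t)" for t u
  proof -
    have p: "opair t (app x t) \<in> elts x" "opair t (app y t) \<in> elts y" "opair t (app z t) \<in> elts z"
      "opair t (app (cf h) t) \<in> elts (cf h)"
      using app_iff t assms(5-7) \<open>is_fun J (cf h)\<close> by blast+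
    have q: "app x t \<in> N" "app y t \<in> N" "app z t \<in> N" "app (cf h) t \<in> N"
      using p N_opair N_trans assms(2-4) cf_N by blast+
    have "u \<in> N"
      using u(1) N_trans[OF q(1)] N_trans[OF q(2)] by blast
    show ?thesis
      by (rule main[rule_format, OF t q p \<open>u \<in> N\<close> u])
  qed
  then show ?thesis
    by (intro bexI[of _ "cf h"] conjI[OF \<open>is_fun J (cf h)\<close>] ballI allI impI cf_N)
qed

lemma inner_model_N: "inner_model N"
proof
  show "x \<in> N \<Longrightarrow> y \<in> elts x \<Longrightarrow> y \<in> N" for x y
    by (rule N_trans)
  have "elts (cf (\<lambda>_. VSet {})) = {}"
    using ae_ex by (intro elts_cfI) (auto simp: elts_VSet los_def)
  then show "VSet {} \<in> N"
    by (rule VSet_N)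
  show "VSet (range A) \<in> N" if "\<And>k. A k \<in> N" for A :: "nat \<Rightarrow> 'v"
    using that by (rule N_seq)
  show "VLambda J (\<lambda>_. x) \<in> N" if "J \<in> N" "x \<in> N" for J x
    using that by (rule N_const)
next
  fix J x y
  assume xy: "J \<in> N" "x \<in> N" "y \<in> N" "is_fun J x" "is_fun J y"
  then obtain f g where fg: "x = cf f" "y = cf g"
    by (auto elim!: N_cases)
  have app_x: "opair t a \<in> elts x \<longleftrightarrow> app x t = a" "opair t a \<in> elts y \<longleftrightarrow> app y t = a"
    and app_N: "app x t \<in> N" "app y t \<in> N" if "t \<in> elts J" for t a
  proof -
    show *: "opair t a \<in> elts x \<longleftrightarrow> app x t = a" "opair t a \<in> elts y \<longleftrightarrow> app y t = a" for a
      using app_iff xy that by blast+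
    show "app x t \<in> N" "app y t \<in> N"
      using * N_opair N_trans xy(2,3) by blast+
  qed
  have "VSet {t \<in> elts J. \<exists>a\<in>N. opair t a \<in> elts (cf f) \<and> opair t a \<in> elts (cf g)} \<in> N"
    by (rule N_separation) (rule xy los_intros)+
  also have "{t \<in> elts J. \<exists>a\<in>N. opair t a \<in> elts (cf f) \<and> opair t a \<in> elts (cf g)} =
      {t \<in> elts J. app x t = app y t}"
    using app_x app_N unfolding fg by auto
  finally show "VSet {t \<in> elts J. app x t = app y t} \<in> N" .
  have "VSet {t \<in> elts J. \<exists>a\<in>N. \<exists>b\<in>N. opair t a \<in> elts (cf f) \<and> opair t b \<in> elts (cf g) \<and> a \<in> elts b} \<in> N"
    by (rule N_separation) (rule xy los_intros)+
  also have "{t \<in> elts J. \<exists>a\<in>N. \<exists>b\<in>N. opair t a \<in> elts (cf f) \<and> opair t b \<in> elts (cf g) \<and> a \<in> elts b} =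
      {t \<in> elts J. app x t \<in> elts (app y t)}"
    using app_x app_N unfolding fg by auto
  finally show "VSet {t \<in> elts J. app x t \<in> elts (app y t)} \<in> N" .
qed (rule N_choice)

end

section \<open>Finite sets of ordinals\<close>

lemma elts_finsubsets: "elts (finsubsets \<kappa>) = {a. elts a \<subseteq> elts \<kappa> \<and> finite (elts a)}"
  unfolding finsubsets_def
  by (rule elts_VSet, rule small_subset[OF small_Pow[OF small_elts[of \<kappa>]]]) auto

lemma elts_nsubsets:
  "elts (nsubsets \<kappa> n) = {a. elts a \<subseteq> elts \<kappa> \<and> finite (elts a) \<and> card (elts a) = n}"
  unfolding nsubsets_def
  by (rule elts_VSet, rule small_subset[OF small_Pow[OF small_elts[of \<kappa>]]]) auto

lemma elts_VPow: "elts (VPow x) = {y. elts y \<subseteq> elts x}"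
  unfolding VPow_def by (intro elts_VSet small_Pow) simp

text \<open>In this form all quantifiers are bounded by \<open>elts\<close>, as the Los rules
  require.\<close>

lemma fos_less_iff: "fos_less a b \<longleftrightarrow>
  (\<exists>\<beta>\<in>elts b. \<beta> \<notin> elts a \<and> (\<forall>\<gamma>\<in>elts a. \<gamma> \<notin> elts b \<longrightarrow> \<gamma> \<in> elts \<beta> \<or> \<gamma> = \<beta>) \<and>
     (\<forall>\<gamma>\<in>elts b. \<gamma> \<notin> elts a \<longrightarrow> \<gamma> \<in> elts \<beta> \<or> \<gamma> = \<beta>))"
  unfolding fos_less_def by blast

text \<open>The ground set is recovered from \<open>U\<close>, and any of its members has
  \<open>n\<close> elements. If one of the two ordinals were smaller, the common ground set would
  violate minimality of the other. This justifies the description in \<open>sp\<close>.\<close>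

lemma uniform_on_inj:
  assumes "uniform_on U \<kappa> n" and "uniform_on U \<kappa>' n'"
  shows "\<kappa> = \<kappa>'"
proof -
  have *: "ultrapower UNIV (nsubsets \<kappa> n) U" if "uniform_on U \<kappa> n" for \<kappa> n
    using that inner_model_UNIV
    by (simp add: uniform_on_def ultrapower_def ultrapower_axioms_def)
  have eq: "nsubsets \<kappa> n = nsubsets \<kappa>' n'"
    using *[OF assms(1)] *[OF assms(2)] ultrapower.ground_W by metis
  obtain a where "a \<in> elts (nsubsets \<kappa> n)"
    using ultrapower.ae_ex[OF *[OF assms(1)] ultrapower.ae_True[OF *[OF assms(1)]], of "\<lambda>_. True"]
    by auto
  moreover from this have "a \<in> elts (nsubsets \<kappa>' n')"
    using eq by simp
  ultimately have "n = n'"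
    unfolding elts_nsubsets by simp
  moreover have "nsubsets \<kappa> n \<in> elts U" "nsubsets \<kappa>' n' \<in> elts U"
    using ultrapower.I_W * assms by blast+
  ultimately show ?thesis
    using assms eq Ord_linear[of \<kappa> \<kappa>'] unfolding uniform_on_def by metis
qed

lemma sp_eq: "uniform_on U \<kappa> n \<Longrightarrow> sp U = \<kappa>"
  unfolding sp_def by (rule the_equality) (auto intro: uniform_on_inj)

section \<open>Internal embeddings and finite sets\<close>

context ultrapower
begin

lemma ult_emb_mem_iff: "x \<in> M \<Longrightarrow> y \<in> M \<Longrightarrow> ult_emb M W x \<in> elts (ult_emb M W y) \<longleftrightarrow> x \<in> elts y"
proof -
  assume "x \<in> M" and "y \<in> M"
  then have "ult_emb M W x \<in> elts (ult_emb M W y) \<longleftrightarrow> ae (\<lambda>i. x \<in> elts y)"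
    unfolding ult_emb_eq by (subst cls_mem_iff) (auto intro!: funs_const ae_cong)
  also have "\<dots> \<longleftrightarrow> x \<in> elts y"
    using ae_ex[of "\<lambda>_. x \<in> elts y"] ae_True[of "\<lambda>_. x \<in> elts y"] by auto
  finally show ?thesis .
qed

lemma cls_mem_ult_emb_iff: "f \<in> funs \<Longrightarrow> x \<in> M \<Longrightarrow> cls f \<in> elts (ult_emb M W x) \<longleftrightarrow> ae (\<lambda>i. app f i \<in> elts x)"
  unfolding ult_emb_eq by (subst cls_mem_iff) (auto intro!: funs_const ae_cong)

lemma ae_finite_ball:
  "finite S \<Longrightarrow> (\<And>s. s \<in> S \<Longrightarrow> ae (P s)) \<Longrightarrow> ae (\<lambda>i. \<forall>s\<in>S. P s i)"
proof (induction S rule: finite_induct)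
  case empty
  show ?case
    by (rule ae_True) simp
next
  case (insert s S)
  then have "ae (\<lambda>i. P s i \<and> (\<forall>s\<in>S. P s i))"
    by (intro ae_conj) auto
  then show ?case
    by simp
qed

text \<open>An embedding sends a finite set to its pointwise image: if \<open>f\<close> avoided each
  element of \<open>a\<close> almost everywhere, it would avoid all of them at once.\<close>

lemma mem_ult_emb_finite:
  assumes "a \<in> M" and "finite (elts a)" and "f \<in> funs" and "cls f \<in> elts (ult_emb M W a)"
  obtains x where "x \<in> elts a" and "ae (\<lambda>i. app f i = x)"
proof (rule ccontr)
  assume "\<not> thesis"
  note that' = that
  have n: "\<not> ae (\<lambda>i. app f i = x)" if "x \<in> elts a" for x
    using that'[OF that] \<open>\<not> thesis\<close> by blast
  have "ae (\<lambda>i. app f i \<noteq> x)" if "x \<in> elts a" for x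
  proof -
    \<comment> \<open>The closure properties of \<open>M\<close> compare two functions, so a fixed
      parameter is read as a constant function.\<close>
    have "meas (\<lambda>i. app f i = app (VLambda I (\<lambda>_. x)) i)"
      using assms that M_trans by (intro meas_eq funs_const) blast+
    then have "meas (\<lambda>i. app f i = x)"
      by (simp add: meas_def cong: conj_cong)
    then show ?thesis
      using n[OF that] by (simp add: ae_not)
  qed
  then have "ae (\<lambda>i. \<forall>x\<in>elts a. app f i \<noteq> x)"
    by (rule ae_finite_ball[OF assms(2)])
  moreover have "ae (\<lambda>i. app f i \<in> elts a)"
    using assms cls_mem_ult_emb_iff by simp
  ultimately show False
    using ae_ex[OF ae_conj] by blast
qed

text \<open>If \<open>\<beta>\<close> witnesses \<open>[f] < j\<^sub>W(a)\<close>, a function choosing counterexamples to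
  \<open>f(i) < a\<close> as witnessed by \<open>\<beta>\<close> would represent a counterexample in the ultrapower.\<close>

lemma fos_less_ult_embE:
  assumes f: "f \<in> funs" and a: "a \<in> M" "finite (elts a)"
    and succ: "\<And>\<beta>. \<beta> \<in> M \<Longrightarrow> VSet (insert \<beta> (elts \<beta>)) \<in> M"
    and less: "fos_less (cls f) (ult_emb M W a)"
  obtains P where "ae P" and "\<And>i. i \<in> elts I \<Longrightarrow> P i \<Longrightarrow> fos_less (app f i) a"
proof -
  let ?c = "\<lambda>x. VLambda I (\<lambda>_. x)"
  obtain b where b: "b \<in> elts (ult_emb M W a)" "b \<notin> elts (cls f)"
    "\<And>c. c \<in> elts (cls f) \<longleftrightarrow> c \<notin> elts (ult_emb M W a) \<Longrightarrow> c \<in> elts b \<or> c = b"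
    using less unfolding fos_less_def by blast
  obtain b' where b': "b' \<in> funs" "b = cls b'"
    using b(1) elts_cls[OF funs_const[OF a(1)]] unfolding ult_emb_eq by blast
  obtain \<beta> where \<beta>: "\<beta> \<in> elts a" "ae (\<lambda>i. app b' i = \<beta>)"
    using mem_ult_emb_finite[OF a b'(1)] b(1) b'(2) by blast
  have "\<beta> \<in> M"
    using \<beta>(1) a(1) M_trans by blast
  have b_eq: "b = cls (?c \<beta>)"
    unfolding b'(2) using \<beta>(2)
    by (subst cls_eq_iff[OF b'(1) funs_const[OF \<open>\<beta> \<in> M\<close>]]) (erule ae_mono, auto intro: meas_eq b'(1) funs_const[OF \<open>\<beta> \<in> M\<close>])
  \<comment> \<open>Being at most \<open>\<beta>\<close> is membership in the successor of
    \<open>\<beta>\<close>. A counterexample at \<open>i\<close> is thus an element of the symmetric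
    difference outside \<open>?s\<close>, which is what \<open>funs_choice\<close> selects.\<close>
  let ?s = "VSet (insert \<beta> (elts \<beta>))"
  have s: "elts ?s = insert \<beta> (elts \<beta>)"
    by (intro elts_VSet small_insert) simp
  obtain h where h: "h \<in> funs" and
    h': "\<And>i z. i \<in> elts I \<Longrightarrow> z \<in> elts (app f i) \<longleftrightarrow> z \<notin> elts (app (?c a) i) \<Longrightarrow>
      z \<notin> elts (app (?c ?s) i) \<Longrightarrow>
      (app h i \<in> elts (app f i) \<longleftrightarrow> app h i \<notin> elts (app (?c a) i)) \<and> app h i \<notin> elts (app (?c ?s) i)"
    using funs_choice[OF f funs_const[OF a(1)] funs_const[OF succ[OF \<open>\<beta> \<in> M\<close>]]] by metis
  define Q1 where "Q1 i \<longleftrightarrow> app h i \<in> elts (app f i)" for i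
  define Q2 where "Q2 i \<longleftrightarrow> app h i \<in> elts (app (?c a) i)" for i
  define Q3 where "Q3 i \<longleftrightarrow> app h i \<in> elts (app (?c ?s) i)" for i
  define Q4 where "Q4 i \<longleftrightarrow> app (?c \<beta>) i \<in> elts (app f i)" for i
  note cl = f h funs_const[OF a(1)] funs_const[OF succ[OF \<open>\<beta> \<in> M\<close>]] funs_const[OF \<open>\<beta> \<in> M\<close>]
  have meas: "meas Q1" "meas Q2" "meas Q3" "meas Q4"
    unfolding Q1_def[abs_def] Q2_def[abs_def] Q3_def[abs_def] Q4_def[abs_def]
    by (intro meas_mem cl)+
  have "cls h \<in> elts b \<or> cls h = b \<Longrightarrow> ae Q3"
  proof (elim disjE)
    assume "cls h \<in> elts b"
    then have "ae (\<lambda>i. app h i \<in> elts (app (?c \<beta>) i))"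
      unfolding b_eq by (subst (asm) cls_mem_iff) (rule cl)+
    then show "ae Q3"
      by (rule ae_mono[OF _ meas(3)]) (simp add: Q3_def s)
  next
    assume "cls h = b"
    then have "ae (\<lambda>i. app h i = app (?c \<beta>) i)"
      unfolding b_eq by (subst (asm) cls_eq_iff) (rule cl)+
    then show "ae Q3"
      by (rule ae_mono[OF _ meas(3)]) (simp add: Q3_def s)
  qed
  moreover have "cls h \<in> elts (cls f) \<longleftrightarrow> ae Q1" "cls h \<in> elts (ult_emb M W a) \<longleftrightarrow> ae Q2"
    unfolding ult_emb_eq Q1_def[abs_def] Q2_def[abs_def] by (rule cls_mem_iff; rule cl)+
  ultimately have "ae Q3 \<or> (ae Q1 \<longleftrightarrow> ae Q2)"
    using b(3)[of "cls h"] by blast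
  moreover have "ae Q \<or> ae (\<lambda>i. \<not> Q i)" if "meas Q" for Q
    using ae_not[OF that] by blast
  \<comment> \<open>The class of \<open>h\<close> is no counterexample in the ultrapower. Since
    \<open>W\<close> decides each property, the reason for this holds at almost every
    \<open>i\<close>; there \<open>h(i)\<close> is no counterexample either, and by the choice of
    \<open>h\<close> none exists.\<close>
  ultimately consider "ae Q3" | "ae Q1" "ae Q2" | "ae (\<lambda>i. \<not> Q1 i)" "ae (\<lambda>i. \<not> Q2 i)"
    using meas by blast
  then obtain Q where Q: "ae Q" "\<And>i. Q i \<Longrightarrow> Q3 i \<or> (Q1 i \<longleftrightarrow> Q2 i)"
  proof cases
    case 1
    then show ?thesis
      using that by blast
  next
    case 2
    show ?thesis
      by (rule that[OF ae_conj[OF 2]]) simp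
  next
    case 3
    show ?thesis
      by (rule that[OF ae_conj[OF 3]]) simp
  qed
  have "\<not> ae Q4"
    using b(2) unfolding b_eq Q4_def[abs_def] by (subst (asm) cls_mem_iff) (rule cl, rule cl, assumption)
  then have "ae (\<lambda>i. \<not> Q4 i)"
    using ae_not meas(4) by blast
  show thesis
  proof (rule that)
    show "ae (\<lambda>i. Q i \<and> \<not> Q4 i)"
      by (rule ae_conj) fact+
    fix i
    assume i: "i \<in> elts I" "Q i \<and> \<not> Q4 i"
    have "\<beta> \<notin> elts (app f i)"
      using i by (simp add: Q4_def)
    moreover have "z \<in> elts \<beta> \<or> z = \<beta>" if "z \<in> elts (app f i) \<longleftrightarrow> z \<notin> elts a" for z
    proof (rule ccontr)
      assume "\<not> ?thesis"
      then have "z \<notin> elts ?s"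
        by (simp add: s)
      then have "(Q1 i \<longleftrightarrow> \<not> Q2 i) \<and> \<not> Q3 i"
        using h'[OF i(1), of z] that i(1) by (simp add: Q1_def Q2_def Q3_def)
      then show False
        using Q(2) i(2) by blast
    qed
    ultimately show "fos_less (app f i) a"
      unfolding fos_less_iff using \<beta>(1) by blast
  qed
qed

end

section \<open>Finite sets of ordinals in an ultrapower of the universe\<close>

context V_ultrapower
begin

lemma embV_eq: "embV U x = cf (\<lambda>_. x)"
  by (simp add: ult_emb_eq cf_def)

lemma ult_id_eq: "ult_id U = cf (\<lambda>i. i)"
  by (simp add: ult_id_def ground_W cf_def)

lemma ult_id_mem_embV_iff: "elts X \<subseteq> elts I \<Longrightarrow> ult_id U \<in> elts (embV U X) \<longleftrightarrow> X \<in> elts U"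
proof -
  assume "elts X \<subseteq> elts I"
  then have "{i \<in> elts I. i \<in> elts X} = elts X"
    by blast
  then show ?thesis
    by (simp add: embV_eq ult_id_eq cf_mem_iff ae_def)
qed

lemma los_fos_less: "los (\<lambda>i. fos_less (f i) (g i)) (fos_less (cf f) (cf g))"
  unfolding fos_less_iff by (intro los_intros)

lemma los_Ord: "los (\<lambda>i. Ord (f i)) (Ord (cf f))"
  unfolding Ord_def Transset_def subset_eq by (intro los_intros)

lemma N_succ: "x \<in> N \<Longrightarrow> VSet (insert x (elts x)) \<in> N"
proof (erule N_cases)
  fix f
  assume x: "x = cf f"
  have s: "elts (VSet (insert y (elts y))) = insert y (elts y)" for y :: 'v
    by (intro elts_VSet small_insert) simp
  have "elts (cf (\<lambda>i. VSet (insert (f i) (elts (f i))))) = insert x (elts x)"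
  proof (rule elts_cfI)
    show "insert x (elts x) \<subseteq> N"
      using N_trans[OF cf_N] x by auto
    show "los (\<lambda>i. h i \<in> elts (VSet (insert (f i) (elts (f i))))) (cf h \<in> insert x (elts x))" for h
      unfolding s insert_iff x by (intro los_intros)
  qed
  then show ?thesis
    by (rule VSet_N)
qed

text \<open>Finiteness is not in the Los calculus. An infinite \<open>cf f\<close> would contain an
  injective sequence; countably many conditions on its representatives hold at one index and embed
  the natural numbers into the finite \<open>f i\<close>.\<close>

lemma finite_cf:
  assumes "ae (\<lambda>i. finite (elts (f i)))"
  shows "finite (elts (cf f))"
proof (rule ccontr)
  assume "infinite (elts (cf f))"
  then obtain g :: "nat \<Rightarrow> 'v" where g: "inj g" "range g \<subseteq> elts (cf f)"
    using infinite_countable_subset by blast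
  then have "\<exists>h. g k = cf h" for k
    using N_trans[OF cf_N] N_cases by blast
  then obtain h where h: "g k = cf (h k)" for k
    by metis
  have "ae (\<lambda>i. h k i \<in> elts (f i))" for k
    using g(2) h cf_mem_iff by (metis rangeI subset_eq)
  then have 1: "ae (\<lambda>i. \<forall>k. h k i \<in> elts (f i))"
    by (rule ae_nat)
  have "ae (\<lambda>i. h k i = h l i \<longrightarrow> k = l)" for k l
  proof (cases "k = l")
    case False
    then have "\<not> ae (\<lambda>i. h k i = h l i)"
      using g(1) by (metis h cf_eq_iff injD)
    then have "ae (\<lambda>i. h k i \<noteq> h l i)"
      by (simp add: ae_not)
    then show ?thesis
      by (rule ae_mono) auto
  qed (auto intro: ae_True)
  then have 2: "ae (\<lambda>i. \<forall>k l. h k i = h l i \<longrightarrow> k = l)"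
    by (intro ae_nat)
  obtain i where i: "finite (elts (f i))" "\<forall>k. h k i \<in> elts (f i)" "\<forall>k l. h k i = h l i \<longrightarrow> k = l"
    using ae_ex[OF ae_conj[OF assms ae_conj[OF 1 2]]] by blast
  then have "finite (range (\<lambda>k. h k i))"
    by (intro finite_subset[OF _ i(1)]) blast
  moreover have "inj (\<lambda>k. h k i)"
    using i(3) by (auto intro: injI)
  ultimately show False
    using finite_imageD infinite_UNIV_nat by blast
qed

text \<open>Values in this set are genuine finite sets of ordinals, so they pass the filter
  \<open>fin_ord_sets\<close> in \<open>ult_restrict\<close>.\<close>

lemma embV_finsubsets:
  assumes "Ord \<kappa>" and x: "x \<in> elts (embV U (finsubsets \<kappa>))"
  shows "x \<in> fin_ord_sets"
proof -
  have "x \<in> N"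
    using x N_trans[OF cf_N] unfolding embV_eq by blast
  then obtain f where f: "x = cf f"
    by (rule N_cases)
  then have ae_f: "ae (\<lambda>i. elts (f i) \<subseteq> elts \<kappa> \<and> finite (elts (f i)))"
    using x by (simp add: embV_eq cf_mem_iff elts_finsubsets)
  have "finite (elts (cf f))"
    by (rule finite_cf) (rule ae_mono[OF ae_f], auto)
  moreover have "\<forall>\<beta>\<in>elts (cf f). Ord \<beta>"
  proof -
    have "los (\<lambda>i. \<forall>\<beta>\<in>elts (f i). Ord \<beta>) (\<forall>\<beta>\<in>elts (cf f). Ord \<beta>)"
      by (intro los_ball los_Ord)
    moreover have "ae (\<lambda>i. \<forall>\<beta>\<in>elts (f i). Ord \<beta>)"
      by (rule ae_mono[OF ae_f]) (auto intro: Ord_in_Ord[OF assms(1)])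
    ultimately show ?thesis
      using losD by blast
  qed
  ultimately show ?thesis
    by (simp add: f fin_ord_sets_def)
qed

text \<open>If \<open>f(i) < i\<close>, every element of \<open>f(i)\<close> outside
  \<open>i\<close> is at most some element of \<open>i\<close>, hence below \<open>\<kappa>\<close>.
  The bound by \<open>\<kappa>'\<close> supplies the finiteness of \<open>f(i)\<close>.\<close>

lemma below_ult_id_embV_finsubsets:
  assumes I: "elts I \<subseteq> elts (finsubsets \<kappa>)" and "Ord \<kappa>"
    and x: "x \<in> elts (embV U (finsubsets \<kappa>'))" and less: "fos_less x (ult_id U)"
  shows "x \<in> elts (embV U (finsubsets \<kappa>))"
proof -
  have "x \<in> N"
    using x N_trans[OF cf_N] unfolding embV_eq by blast
  then obtain f where f: "x = cf f"
    by (rule N_cases)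
  have "ae (\<lambda>i. f i \<in> elts (finsubsets \<kappa>'))"
    using x by (simp add: f embV_eq cf_mem_iff)
  moreover have "ae (\<lambda>i. fos_less (f i) i)"
    using less losD[OF los_fos_less] by (simp add: f ult_id_eq)
  ultimately have "ae (\<lambda>i. f i \<in> elts (finsubsets \<kappa>') \<and> fos_less (f i) i)"
    by (rule ae_conj)
  then have "ae (\<lambda>i. f i \<in> elts (finsubsets \<kappa>))"
  proof (rule ae_mono)
    fix i
    assume i: "i \<in> elts I" and *: "f i \<in> elts (finsubsets \<kappa>') \<and> fos_less (f i) i"
    then have "elts i \<subseteq> elts \<kappa>"
      using I by (auto simp: elts_finsubsets)
    then have "elts (f i) \<subseteq> elts \<kappa>"
      using * Ord_mem_trans[OF \<open>Ord \<kappa>\<close>] unfolding fos_less_iff by blast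
    then show "f i \<in> elts (finsubsets \<kappa>)"
      using * by (auto simp: elts_finsubsets)
  qed simp
  then show ?thesis
    by (simp add: f embV_eq cf_mem_iff)
qed

text \<open>When \<open>f\<close> and \<open>r\<close> are functions, this is the set of all \<open>X \<subseteq> S\<close> in the domain of \<open>r\<close> with
  \<open>{t. f(t) \<in> r(X)} \<in> W\<close>, with the applications of functions written out.\<close>

lemma N_internal_preimage:
  assumes "W \<in> N" "f \<in> N" "r \<in> N" "S \<in> N"
  shows "VSet {X \<in> elts (VSet (\<Union>y\<in>elts (VSet (\<Union>x\<in>elts r. elts x)). elts y)).
    (\<forall>z\<in>elts X. z \<in> elts S) \<and> (\<exists>B\<in>elts W. \<exists>Z\<in>N. opair X Z \<in> elts r \<and>
      (\<forall>t\<in>elts B. \<exists>v\<in>elts Z. opair t v \<in> elts f))} \<in> N"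
proof -
  obtain w g q s where "W = cf w" "f = cf g" "r = cf q" "S = cf s"
    using assms by (auto elim!: N_cases)
  then show ?thesis
    by (simp only:) (rule N_separation, (rule N_Union cf_N los_intros)+)
qed

end

section \<open>Dodd solid ultrafilters\<close>

theorem theorem5p10:
  fixes U\<^sub>0 U\<^sub>1 :: "'v::zfc"
  assumes "uniform_ultrafilter U\<^sub>0"
    and "Dodd_solid U\<^sub>1"
    and "seed_less U\<^sub>0 U\<^sub>1"
  shows "mitchell_less U\<^sub>0 U\<^sub>1"
proof -
  obtain \<kappa>\<^sub>0 n\<^sub>0 where u0: "uniform_on U\<^sub>0 \<kappa>\<^sub>0 n\<^sub>0"
    using assms(1) by (auto simp: uniform_ultrafilter_def)
  obtain \<kappa>\<^sub>1 n\<^sub>1 where u1: "uniform_on U\<^sub>1 \<kappa>\<^sub>1 n\<^sub>1"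
    using assms(2) by (auto simp: Dodd_solid_def uniform_ultrafilter_def)
  obtain W\<^sub>0 W\<^sub>1 I\<^sub>0 I\<^sub>1 where cc0: "cc_ultrafilter (UltV U\<^sub>0) I\<^sub>0 W\<^sub>0"
    and cc1: "cc_ultrafilter (UltV U\<^sub>1) I\<^sub>1 W\<^sub>1"
    and same_ult: "Ult (UltV U\<^sub>0) W\<^sub>0 = Ult (UltV U\<^sub>1) W\<^sub>1"
    and same_emb: "ult_emb (UltV U\<^sub>0) W\<^sub>0 (embV U\<^sub>0 x) = ult_emb (UltV U\<^sub>1) W\<^sub>1 (embV U\<^sub>1 x)"
    and less: "fos_less (ult_emb (UltV U\<^sub>0) W\<^sub>0 (ult_id U\<^sub>0)) (ult_emb (UltV U\<^sub>1) W\<^sub>1 (ult_id U\<^sub>1))" for x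
    using assms(3) unfolding seed_less_def internal_comparison_def by blast
  let ?S = "nsubsets \<kappa>\<^sub>0 n\<^sub>0" and ?F = "finsubsets \<kappa>\<^sub>1"
  have ord: "Ord \<kappa>\<^sub>0" "Ord \<kappa>\<^sub>1"
    using u0 u1 by (auto simp: uniform_on_def)
  interpret V0: V_ultrapower ?S U\<^sub>0
    using u0 by unfold_locales (simp add: uniform_on_def)
  interpret V1: V_ultrapower "nsubsets \<kappa>\<^sub>1 n\<^sub>1" U\<^sub>1
    using u1 by unfold_locales (simp add: uniform_on_def)
  interpret M0: ultrapower "UltV U\<^sub>0" I\<^sub>0 W\<^sub>0
    using V0.inner_model_N cc0 by (simp add: ultrapower_def ultrapower_axioms_def)
  interpret M1: ultrapower "UltV U\<^sub>1" I\<^sub>1 W\<^sub>1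
    using V1.inner_model_N cc1 by (simp add: ultrapower_def ultrapower_axioms_def)
  define a where "a = ult_id U\<^sub>1"
  define y where "y = ult_emb (UltV U\<^sub>0) W\<^sub>0 (ult_id U\<^sub>0)"
  have emb_N: "embV U\<^sub>0 x \<in> UltV U\<^sub>0" "embV U\<^sub>1 x \<in> UltV U\<^sub>1" for x
    by (simp_all add: V0.embV_eq V1.embV_eq)
  have id_N: "ult_id U\<^sub>0 \<in> UltV U\<^sub>0" "a \<in> UltV U\<^sub>1"
    by (simp_all add: a_def V0.ult_id_eq V1.ult_id_eq)
  \<comment> \<open>The coincidence of the two targets lets \<open>y\<close>, which comes from the
    side of \<open>U\<^sub>0\<close>, be represented by a function \<open>f\<close> of
    \<open>Ult(V, U\<^sub>1)\<close>.\<close>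
  have "y \<in> Ult (UltV U\<^sub>1) W\<^sub>1"
    unfolding y_def same_ult[symmetric] M0.ult_emb_eq by (intro M0.cls_mem_Ult M0.funs_const id_N)
  then obtain f where f: "f \<in> M1.funs" and y: "y = M1.cls f"
    unfolding M1.Ult_eq by blast
  have seed: "ult_id U\<^sub>0 \<in> elts (embV U\<^sub>0 X) \<longleftrightarrow> M1.ae (\<lambda>t. app f t \<in> elts (embV U\<^sub>1 X))" for X
    using M0.ult_emb_mem_iff[OF id_N(1) emb_N(1), of X] M1.cls_mem_ult_emb_iff[OF f emb_N(2), of X]
    by (simp add: same_emb flip: y y_def)
  have "elts ?S \<subseteq> elts (finsubsets \<kappa>\<^sub>0)"
    by (auto simp: elts_nsubsets elts_finsubsets)
  have S1: "elts (nsubsets \<kappa>\<^sub>1 n\<^sub>1) \<subseteq> elts ?F"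
    by (auto simp: elts_nsubsets elts_finsubsets)
  have "ult_id U\<^sub>0 \<in> elts (embV U\<^sub>0 (finsubsets \<kappa>\<^sub>0))"
    using \<open>elts ?S \<subseteq> _\<close> unfolding V0.ult_id_eq V0.embV_eq V0.cf_mem_iff
    by (intro V0.ae_True) blast
  \<comment> \<open>The bound by \<open>\<kappa>\<^sub>0\<close> is provisional: together with
    \<open>f(t) < a\<close> it improves to the bound by \<open>\<kappa>\<^sub>1\<close> in
    \<open>f_F\<close>.\<close>
  then have fin0: "M1.ae (\<lambda>t. app f t \<in> elts (embV U\<^sub>1 (finsubsets \<kappa>\<^sub>0)))"
    by (simp add: seed)
  have a_F: "a \<in> elts (embV U\<^sub>1 ?F)"
    using S1 unfolding a_def V1.ult_id_eq V1.embV_eq V1.cf_mem_iff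
    by (intro V1.ae_True) blast
  have "finite (elts a)"
    using V1.embV_finsubsets[OF ord(2) a_F] by (simp add: fin_ord_sets_def)
  moreover have "fos_less (M1.cls f) (ult_emb (UltV U\<^sub>1) W\<^sub>1 a)"
    using less by (simp add: a_def flip: y y_def)
  ultimately obtain P where P: "M1.ae P" "\<And>t. t \<in> elts I\<^sub>1 \<Longrightarrow> P t \<Longrightarrow> fos_less (app f t) a"
    using M1.fos_less_ult_embE[OF f id_N(2) _ V1.N_succ] by metis
  have f_F: "M1.ae (\<lambda>t. app f t \<in> elts (embV U\<^sub>1 ?F))"
  proof (rule M1.ae_mono[OF M1.ae_conj[OF P(1) fin0]])
    have "M1.meas (\<lambda>t. app f t \<in> elts (app (VLambda I\<^sub>1 (\<lambda>_. embV U\<^sub>1 ?F)) t))"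
      by (intro M1.meas_mem f M1.funs_const emb_N)
    then show "M1.meas (\<lambda>t. app f t \<in> elts (embV U\<^sub>1 ?F))"
      by (simp add: M1.meas_def cong: conj_cong)
    show "app f t \<in> elts (embV U\<^sub>1 ?F)"
      if "t \<in> elts I\<^sub>1" "P t \<and> app f t \<in> elts (embV U\<^sub>1 (finsubsets \<kappa>\<^sub>0))" for t
      using V1.below_ult_id_embV_finsubsets[OF S1 ord(2)] that P(2) unfolding a_def by blast
  qed
  then have "V0.ae (\<lambda>i. i \<in> elts ?F)"
    by (simp add: V0.ult_id_eq V0.embV_eq V0.cf_mem_iff flip: seed)
  \<comment> \<open>Read back through \<open>seed\<close>, \<open>f_F\<close> says that almost all
    members of \<open>?S\<close> are subsets of \<open>\<kappa>\<^sub>1\<close>; minimality of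
    \<open>\<kappa>\<^sub>0\<close> forbids this for smaller \<open>\<kappa>\<^sub>1\<close>.
    Consequently every subset of \<open>?S\<close> is an argument of \<open>r\<close>.\<close>
  have "elts \<kappa>\<^sub>0 \<subseteq> elts \<kappa>\<^sub>1"
  proof (rule ccontr)
    assume "\<not> elts \<kappa>\<^sub>0 \<subseteq> elts \<kappa>\<^sub>1"
    then have "\<kappa>\<^sub>1 \<in> elts \<kappa>\<^sub>0"
      using Ord_linear[OF ord] Ord_mem_trans[OF ord(2)] by blast
    then have "elts \<kappa>\<^sub>1 \<subseteq> elts \<kappa>\<^sub>0"
      using Ord_mem_trans[OF ord(1)] by blast
    then have "{i \<in> elts ?S. i \<in> elts ?F} = elts (nsubsets \<kappa>\<^sub>1 n\<^sub>0)"
      by (auto simp: elts_nsubsets elts_finsubsets)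
    then have "nsubsets \<kappa>\<^sub>1 n\<^sub>0 \<in> elts U\<^sub>0"
      using \<open>V0.ae _\<close> by (simp add: V0.ae_def)
    then show False
      using u0 \<open>\<kappa>\<^sub>1 \<in> elts \<kappa>\<^sub>0\<close> by (simp add: uniform_on_def)
  qed
  then have S_F: "elts ?S \<subseteq> elts ?F"
    by (auto simp: elts_nsubsets elts_finsubsets)
  define r where "r = ult_restrict U\<^sub>1 a"
  define R where "R X = VSet (elts (embV U\<^sub>1 X) \<inter> {b \<in> fin_ord_sets. fos_less b a})" for X
  have r_N: "r \<in> UltV U\<^sub>1"
    using assms(2) by (simp add: Dodd_solid_def r_def a_def)
  have r_iff: "opair X Z \<in> elts r \<longleftrightarrow> elts X \<subseteq> elts ?F \<and> Z = R X" for X Z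
    unfolding r_def ult_restrict_def sp_eq[OF u1] elts_VLambda
    by (auto simp: elts_VPow R_def)
  have elts_R: "elts (R X) = elts (embV U\<^sub>1 X) \<inter> {b \<in> fin_ord_sets. fos_less b a}" for X
    unfolding R_def by (rule elts_VSet, rule small_subset[OF small_elts]) blast
  have R_N: "R X \<in> UltV U\<^sub>1" if "elts X \<subseteq> elts ?F" for X
    using V1.N_opair V1.N_trans[OF r_N] r_iff that by blast
  have U0_iff: "X \<in> elts U\<^sub>0 \<longleftrightarrow> M1.ae (\<lambda>t. app f t \<in> elts (R X))" if X: "elts X \<subseteq> elts ?S" for X
  proof -
    have "X \<in> elts U\<^sub>0 \<longleftrightarrow> M1.ae (\<lambda>t. app f t \<in> elts (embV U\<^sub>1 X))"
      using V0.ult_id_mem_embV_iff[OF X] seed by simp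
    also have "\<dots> \<longleftrightarrow> M1.ae (\<lambda>t. app f t \<in> elts (R X))"
    proof
      assume *: "M1.ae (\<lambda>t. app f t \<in> elts (embV U\<^sub>1 X))"
      show "M1.ae (\<lambda>t. app f t \<in> elts (R X))"
      proof (rule M1.ae_mono[OF M1.ae_conj[OF * M1.ae_conj[OF P(1) f_F]]])
        have "R X \<in> UltV U\<^sub>1"
          using R_N X S_F by blast
        then have "M1.meas (\<lambda>t. app f t \<in> elts (app (VLambda I\<^sub>1 (\<lambda>_. R X)) t))"
          by (intro M1.meas_mem f M1.funs_const)
        then show "M1.meas (\<lambda>t. app f t \<in> elts (R X))"
          by (simp add: M1.meas_def cong: conj_cong)
      qed (use P(2) V1.embV_finsubsets[OF ord(2)] in \<open>auto simp: elts_R\<close>)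
    next
      assume *: "M1.ae (\<lambda>t. app f t \<in> elts (R X))"
      have "M1.meas (\<lambda>t. app f t \<in> elts (app (VLambda I\<^sub>1 (\<lambda>_. embV U\<^sub>1 X)) t))"
        by (intro M1.meas_mem f M1.funs_const emb_N)
      then have "M1.meas (\<lambda>t. app f t \<in> elts (embV U\<^sub>1 X))"
        by (simp add: M1.meas_def cong: conj_cong)
      with * show "M1.ae (\<lambda>t. app f t \<in> elts (embV U\<^sub>1 X))"
        by (rule M1.ae_mono) (simp add: elts_R)
    qed
    finally show ?thesis .
  qed
  \<comment> \<open>Almost-everywhere truth is restated as the existence of \<open>B\<close> in
    \<open>W\<^sub>1\<close>, with pairs in place of \<open>app\<close>, to match the instance of
    Separation.\<close>
  have ae_iff: "M1.ae (\<lambda>t. app f t \<in> elts (R X)) \<longleftrightarrow> (\<exists>B\<in>elts W\<^sub>1. \<exists>Z\<in>UltV U\<^sub>1. opair X Z \<in> elts r \<and>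
      (\<forall>t\<in>elts B. \<exists>v\<in>elts Z. opair t v \<in> elts f))" if X: "elts X \<subseteq> elts ?F" for X
  proof -
    have f_iff: "opair t v \<in> elts f \<longleftrightarrow> t \<in> elts I\<^sub>1 \<and> app f t = v" for t v
      by (rule app_iff[OF M1.funsD(2)[OF f]])
    have "M1.meas (\<lambda>t. app f t \<in> elts (app (VLambda I\<^sub>1 (\<lambda>_. R X)) t))"
      by (intro M1.meas_mem f M1.funs_const R_N X)
    then have meas: "M1.meas (\<lambda>t. app f t \<in> elts (R X))"
      by (simp add: M1.meas_def cong: conj_cong)
    have "M1.ae (\<lambda>t. app f t \<in> elts (R X))"
      if B: "B \<in> elts W\<^sub>1" "\<forall>t\<in>elts B. app f t \<in> elts (R X)" for B
    proof (rule M1.ae_mono[OF _ meas])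
      have "{t \<in> elts I\<^sub>1. t \<in> elts B} = elts B"
        using M1.W_sub[OF B(1)] by blast
      then show "M1.ae (\<lambda>t. t \<in> elts B)"
        using B(1) by (simp add: M1.ae_def)
    qed (use B in blast)
    moreover have "\<exists>B\<in>elts W\<^sub>1. \<forall>t\<in>elts B. t \<in> elts I\<^sub>1 \<and> app f t \<in> elts (R X)"
      if "M1.ae (\<lambda>t. app f t \<in> elts (R X))"
      using that unfolding M1.ae_def by (rule rev_bexI) simp
    moreover have "opair X Z \<in> elts r \<longleftrightarrow> Z = R X" for Z
      using X by (simp add: r_iff)
    ultimately show ?thesis
      using R_N[OF X] by (auto simp: f_iff)
  qed
  define Y where "Y = VSet {X \<in> elts (VSet (\<Union>y\<in>elts (VSet (\<Union>x\<in>elts r. elts x)). elts y)).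
    (\<forall>z\<in>elts X. z \<in> elts ?S) \<and> (\<exists>B\<in>elts W\<^sub>1. \<exists>Z\<in>UltV U\<^sub>1. opair X Z \<in> elts r \<and>
      (\<forall>t\<in>elts B. \<exists>v\<in>elts Z. opair t v \<in> elts f))}"
  \<comment> \<open>As an argument of \<open>r\<close>, the set \<open>?S\<close> belongs to the
    transitive class \<open>Ult(V, U\<^sub>1)\<close>.\<close>
  have "opair ?S (R ?S) \<in> elts r"
    using S_F by (simp add: r_iff)
  then have "?S \<in> UltV U\<^sub>1"
    using V1.N_opair V1.N_trans[OF r_N] by blast
  then have "Y \<in> UltV U\<^sub>1"
    unfolding Y_def by (intro V1.N_internal_preimage M1.W_M M1.funsD(1)[OF f] r_N)
  moreover have "Y = U\<^sub>0"
  proof (rule zfc_extensionality, rule set_eqI)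
    fix X
    \<comment> \<open>The double union of \<open>r\<close> covers its domain, because
      \<open>X\<close> lies in the member \<open>{X}\<close> of the pair. All subsets of
      \<open>?S\<close> are therefore available to Separation.\<close>
    have dom: "X \<in> elts (VSet (\<Union>y\<in>elts (VSet (\<Union>x\<in>elts r. elts x)). elts y))" if "opair X Z \<in> elts r" for Z
    proof -
      have "elts (VSet (\<Union>x\<in>elts z. elts x)) = (\<Union>x\<in>elts z. elts x)" for z :: 'v
        by (intro elts_VSet small_UN) auto
      moreover have "VSet {X} \<in> elts (opair X Z)" "X \<in> elts (VSet {X})"
        by (simp_all add: opair_def elts_VSet)
      ultimately show ?thesis
        using that by blast
    qed
    have "X \<in> elts Y \<longleftrightarrow> elts X \<subseteq> elts ?S \<and> (\<exists>B\<in>elts W\<^sub>1. \<exists>Z\<in>UltV U\<^sub>1. opair X Z \<in> elts r \<and>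
      (\<forall>t\<in>elts B. \<exists>v\<in>elts Z. opair t v \<in> elts f))"
      unfolding Y_def elts_VSet[OF small_Collect] using dom by blast
    also have "\<dots> \<longleftrightarrow> elts X \<subseteq> elts ?S \<and> X \<in> elts U\<^sub>0"
      using ae_iff[of X] U0_iff[of X] S_F by blast
    also have "\<dots> \<longleftrightarrow> X \<in> elts U\<^sub>0"
      using V0.W_sub by blast
    finally show "X \<in> elts Y \<longleftrightarrow> X \<in> elts U\<^sub>0" .
  qed
  ultimately show ?thesis
    by (simp add: mitchell_less_def)
qed

end
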